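(* Let $m+n\ge5$. Let $\widetilde{\mathfrak{st}}_{m|n}(\mathbb{C}[u,v])$ be the Lie superalgebra over $\mathbb{C}$ generated by elements $\widetilde F_{a,b}(1),\widetilde F_{a,b}(u),\widetilde F_{a,b}(v)$, $1\le a\ne b\le m+n$, each of parity $|a|+|b|\in\mathbb{Z}_2$, subject to the following relations. For $a\ne b\ne c\ne d\ne a$: $$[\widetilde F_{a,b}(u),\widetilde F_{c,d}(u)]=0,\quad[\widetilde F_{a,b}(u),\widetilde F_{c,d}(v)]=0,\quad[\widetilde F_{a,b}(v),\widetilde F_{c,d}(v)]=0,$$ $$[\widetilde F_{a,b}(u),\widetilde F_{c,d}(1)]=0,\quad[\widetilde F_{a,b}(v),\widetilde F_{c,d}(1)]=0,\quad[\widetilde F_{a,b}(1),\widetilde F_{c,d}(1)]=0.$$ For $a,b,c$ all distinct and $a,c,d$ all distinct: $$[\widetilde F_{a,b}(u),\widetilde F_{b,c}(u)]=[\widetilde F_{a,d}(u),\widetilde F_{d,c}(u)],\quad[\widetilde F_{a,b}(u),\widetilde F_{b,c}(v)]=[\widetilde F_{a,d}(v),\widetilde F_{d,c}(u)],$$ $$[\widetilde F_{a,b}(v),\widetilde F_{b,c}(v)]=[\widetilde F_{a,d}(v),\widetilde F_{d,c}(v)],$$ $$[\widetilde F_{a,b}(u^i),\widetilde F_{b,c}(u^j)]=\widetilde F_{a,c}(u^{i+j}),\quad[\widetilde F_{a,b}(v^i),\widetilde F_{b,c}(v^j)]=\widetilde F_{a,c}(v^{i+j})\qquad(i,j\ge0,\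 i+j\in\{0,1\}).$$ Then there is an isomorphism of Lie superalgebras $\widetilde{\mathfrak{st}}_{m|n}(\mathbb{C}[u,v])\simeq\mathfrak{st}_{m|n}(\mathbb{C}[u,v])$.
   Context: Parity: $|i|=0$ for $1\le i\le m$, $|i|=1$ for $m+1\le i\le m+n$. Brackets are Lie superbrackets. Notation like $a\ne b\ne c\ne d\ne a$ means only that consecutive indices are distinct. For an associative (purely even, here $A=\mathbb{C}[u,v]$) algebra $A$ over $\mathbb{C}$ and $m+n\ge3$, the Steinberg Lie superalgebra $\mathfrak{st}_{m|n}(A)$ is the Lie superalgebra over $\mathbb{C}$ generated by elements $F_{i,j}(a)$, $a\in A$, $1\le i\ne j\le m+n$, of parity $|i|+|j|$, subject to: $a\mapsto F_{i,j}(a)$ is $\mathbb{C}$-linear; $[F_{i,j}(a),F_{j,k}(b)]=F_{i,k}(ab)$ for distinct $i,j,k$; $[F_{i,j}(a),F_{k,q}(b)]=0$ for $i\ne j\ne k\ne q\ne i$. *)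

theory Defs
  imports
    "HOL-Algebra.Algebraic_Closure_Type"
    "HOL-Library.Poly_Mapping"
    "HOL-Library.Z2"
begin

section \<open>Lie superalgebras over the complex numbers\<close>

text \<open>
  The bracket is the field \<open>mult\<close> of the module record, so \<open>x \<otimes>\<^bsub>L\<^esub> y\<close> reads \<open>[x, y]\<close>; the field
  \<open>one\<close> that the record also carries plays no role. \<open>part L d\<close> is the homogeneous
  component of degree \<open>d \<in> \<int>/2\<close>.
\<close>

record 'a superalgebra = "(complex, 'a) module" +
  part :: "bit \<Rightarrow> 'a set"

abbreviation complex_field :: "complex ring" where
  "complex_field \<equiv> ring_of_type_algebra"

definition koszul :: "bit \<Rightarrow> bit \<Rightarrow> complex" where
  "koszul d e = (if d = 1 \<and> e = 1 then - 1 else 1)"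

locale lie_superalgebra = module complex_field L for L :: "('a, 'b) superalgebra_scheme" (structure) +
  assumes part_submodule: "submodule (part L d) complex_field L"
    and part_sum: "x \<in> carrier L \<Longrightarrow> \<exists>y\<in>part L 0. \<exists>z\<in>part L 1. x = y \<oplus> z"
    and part_disjoint: "part L 0 \<inter> part L 1 = {\<zero>}"
    and bracket_closed: "\<lbrakk>x \<in> carrier L; y \<in> carrier L\<rbrakk> \<Longrightarrow> x \<otimes> y \<in> carrier L"
    and bracket_add_left: "\<lbrakk>x \<in> carrier L; y \<in> carrier L; z \<in> carrier L\<rbrakk> \<Longrightarrow>
      (x \<oplus> y) \<otimes> z = x \<otimes> z \<oplus> y \<otimes> z"
    and bracket_add_right: "\<lbrakk>x \<in> carrier L; y \<in> carrier L; z \<in> carrier L\<rbrakk> \<Longrightarrow>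
      x \<otimes> (y \<oplus> z) = x \<otimes> y \<oplus> x \<otimes> z"
    and bracket_smult_left: "\<lbrakk>x \<in> carrier L; y \<in> carrier L\<rbrakk> \<Longrightarrow> (c \<odot> x) \<otimes> y = c \<odot> (x \<otimes> y)"
    and bracket_smult_right: "\<lbrakk>x \<in> carrier L; y \<in> carrier L\<rbrakk> \<Longrightarrow> x \<otimes> (c \<odot> y) = c \<odot> (x \<otimes> y)"
    and bracket_part: "\<lbrakk>x \<in> part L d; y \<in> part L e\<rbrakk> \<Longrightarrow> x \<otimes> y \<in> part L (d + e)"
    and super_skew: "\<lbrakk>x \<in> part L d; y \<in> part L e\<rbrakk> \<Longrightarrow>
      x \<otimes> y \<oplus> koszul d e \<odot> (y \<otimes> x) = \<zero>"
    and super_jacobi: "\<lbrakk>x \<in> part L d; y \<in> part L e; z \<in> part L f\<rbrakk> \<Longrightarrow>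
      x \<otimes> (y \<otimes> z) = (x \<otimes> y) \<otimes> z \<oplus> koszul d e \<odot> (y \<otimes> (x \<otimes> z))"

definition lie_super_hom ::
    "('a, 'c) superalgebra_scheme \<Rightarrow> ('b, 'd) superalgebra_scheme \<Rightarrow> ('a \<Rightarrow> 'b) set" where
  "lie_super_hom L M = {f. f \<in> carrier L \<rightarrow> carrier M \<and>
     (\<forall>x\<in>carrier L. \<forall>y\<in>carrier L. f (x \<oplus>\<^bsub>L\<^esub> y) = f x \<oplus>\<^bsub>M\<^esub> f y) \<and>
     (\<forall>c. \<forall>x\<in>carrier L. f (c \<odot>\<^bsub>L\<^esub> x) = c \<odot>\<^bsub>M\<^esub> f x) \<and>
     (\<forall>x\<in>carrier L. \<forall>y\<in>carrier L. f (x \<otimes>\<^bsub>L\<^esub> y) = f x \<otimes>\<^bsub>M\<^esub> f y) \<and>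
     (\<forall>d. f ` part L d \<subseteq> part M d)}"

definition lie_super_iso ::
    "('a, 'c) superalgebra_scheme \<Rightarrow> ('b, 'd) superalgebra_scheme \<Rightarrow> ('a \<Rightarrow> 'b) set" where
  "lie_super_iso L M = {f \<in> lie_super_hom L M. bij_betw f (carrier L) (carrier M)}"

definition lie_super_isomorphic ::
    "('a, 'c) superalgebra_scheme \<Rightarrow> ('b, 'd) superalgebra_scheme \<Rightarrow> bool" where
  "lie_super_isomorphic L M \<longleftrightarrow> lie_super_iso L M \<noteq> {}"


section \<open>Lie superalgebras given by generators and relations\<close>

text \<open>
  The free nonassociative algebra on \<open>'g\<close> has the bracketed words over \<open>'g\<close> as a basis. The Lie
  superalgebra with generators \<open>G\<close>, parities \<open>p\<close> and relators \<open>R\<close> (elements required to vanish) is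
  the quotient of the free nonassociative superalgebra on \<open>G\<close> by the two-sided ideal generated by
  \<open>R\<close> together with all instances of super skew-symmetry and of the super Jacobi identity.
\<close>

datatype (gens: 'g) word = Gen 'g | Br "'g word" "'g word"

primrec word_parity :: "('g \<Rightarrow> bit) \<Rightarrow> 'g word \<Rightarrow> bit" where
  "word_parity p (Gen g) = p g"
| "word_parity p (Br s t) = word_parity p s + word_parity p t"

type_synonym 'g free_alg = "'g word \<Rightarrow>\<^sub>0 complex"

definition gen :: "'g \<Rightarrow> 'g free_alg" where
  "gen g = Poly_Mapping.single (Gen g) 1"

definition scale :: "complex \<Rightarrow> 'g free_alg \<Rightarrow> 'g free_alg" where
  "scale c x = Poly_Mapping.map ((*) c) x"

definition br :: "'g free_alg \<Rightarrow> 'g free_alg \<Rightarrow> 'g free_alg" where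
  "br x y = (\<Sum>s\<in>Poly_Mapping.keys x. \<Sum>t\<in>Poly_Mapping.keys y.
     Poly_Mapping.single (Br s t) (Poly_Mapping.lookup x s * Poly_Mapping.lookup y t))"

definition free_carrier :: "'g set \<Rightarrow> 'g free_alg set" where
  "free_carrier G = {x. \<forall>t\<in>Poly_Mapping.keys x. gens t \<subseteq> G}"

definition free_part :: "'g set \<Rightarrow> ('g \<Rightarrow> bit) \<Rightarrow> bit \<Rightarrow> 'g free_alg set" where
  "free_part G p d = {x \<in> free_carrier G. \<forall>t\<in>Poly_Mapping.keys x. word_parity p t = d}"

inductive_set lie_ideal :: "'g set \<Rightarrow> ('g \<Rightarrow> bit) \<Rightarrow> 'g free_alg set \<Rightarrow> 'g free_alg set"
  for G p R where
  relator: "r \<in> R \<Longrightarrow> r \<in> lie_ideal G p R"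
| skew: "\<lbrakk>x \<in> free_part G p d; y \<in> free_part G p e\<rbrakk> \<Longrightarrow>
    br x y + scale (koszul d e) (br y x) \<in> lie_ideal G p R"
| jacobi: "\<lbrakk>x \<in> free_part G p d; y \<in> free_part G p e; z \<in> free_part G p f\<rbrakk> \<Longrightarrow>
    br x (br y z) - (br (br x y) z + scale (koszul d e) (br y (br x z))) \<in> lie_ideal G p R"
| zero: "0 \<in> lie_ideal G p R"
| add: "\<lbrakk>x \<in> lie_ideal G p R; y \<in> lie_ideal G p R\<rbrakk> \<Longrightarrow> x + y \<in> lie_ideal G p R"
| scale: "x \<in> lie_ideal G p R \<Longrightarrow> scale c x \<in> lie_ideal G p R"
| br_left: "\<lbrakk>x \<in> lie_ideal G p R; y \<in> free_carrier G\<rbrakk> \<Longrightarrow> br y x \<in> lie_ideal G p R"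
| br_right: "\<lbrakk>x \<in> lie_ideal G p R; y \<in> free_carrier G\<rbrakk> \<Longrightarrow> br x y \<in> lie_ideal G p R"

definition lie_cong :: "'g set \<Rightarrow> ('g \<Rightarrow> bit) \<Rightarrow> 'g free_alg set \<Rightarrow> ('g free_alg \<times> 'g free_alg) set" where
  "lie_cong G p R = {(x, y). x \<in> free_carrier G \<and> y \<in> free_carrier G \<and> x - y \<in> lie_ideal G p R}"

definition lie_class :: "'g set \<Rightarrow> ('g \<Rightarrow> bit) \<Rightarrow> 'g free_alg set \<Rightarrow> 'g free_alg \<Rightarrow> 'g free_alg set" where
  "lie_class G p R x = lie_cong G p R `` {x}"

definition presented_lie ::
    "'g set \<Rightarrow> ('g \<Rightarrow> bit) \<Rightarrow> 'g free_alg set \<Rightarrow> 'g free_alg set superalgebra" where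
  "presented_lie G p R =
     \<lparr>carrier = free_carrier G // lie_cong G p R,
      monoid.mult = (\<lambda>A B. \<Union>x\<in>A. \<Union>y\<in>B. lie_class G p R (br x y)),
      monoid.one = undefined,
      ring.zero = lie_class G p R 0,
      ring.add = (\<lambda>A B. \<Union>x\<in>A. \<Union>y\<in>B. lie_class G p R (x + y)),
      module.smult = (\<lambda>c A. \<Union>x\<in>A. lie_class G p R (scale c x)),
      part = (\<lambda>d. lie_class G p R ` free_part G p d)\<rparr>"


section \<open>Steinberg Lie superalgebras\<close>

definition index_parity :: "nat \<Rightarrow> nat \<Rightarrow> bit" where
  "index_parity m i = (if i \<le> m then 0 else 1)"

text \<open>The triple \<open>(i, j, a)\<close> stands for the generator \<open>F\<^sub>i\<^sub>,\<^sub>j(a)\<close>.\<close>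

type_synonym 'a st_gen = "nat \<times> nat \<times> 'a"

definition st_parity :: "nat \<Rightarrow> 'a st_gen \<Rightarrow> bit" where
  "st_parity m = (\<lambda>(i, j, a). index_parity m i + index_parity m j)"

abbreviation F :: "nat \<Rightarrow> nat \<Rightarrow> 'a \<Rightarrow> 'a st_gen free_alg" where
  "F i j a \<equiv> gen (i, j, a)"

definition st_gens :: "nat \<Rightarrow> nat \<Rightarrow> 'a set \<Rightarrow> 'a st_gen set" where
  "st_gens m n S = {(i, j, a). i \<in> {1..m+n} \<and> j \<in> {1..m+n} \<and> i \<noteq> j \<and> a \<in> S}"

text \<open>
  In the following, \<open>sc\<close> is the scalar multiplication of the complex algebra \<open>'a\<close>.
\<close>

definition steinberg_rels ::
    "(complex \<Rightarrow> 'a::ring \<Rightarrow> 'a) \<Rightarrow> nat \<Rightarrow> nat \<Rightarrow> 'a st_gen free_alg set" where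
  "steinberg_rels sc m n = (let I = {1..m+n} in
     {F i j (a + b) - (F i j a + F i j b) | i j a b. {i, j} \<subseteq> I \<and> i \<noteq> j} \<union>
     {F i j (sc c a) - scale c (F i j a) | i j a c. {i, j} \<subseteq> I \<and> i \<noteq> j} \<union>
     {br (F i j a) (F j k b) - F i k (a * b) | i j k a b.
        {i, j, k} \<subseteq> I \<and> i \<noteq> j \<and> j \<noteq> k \<and> i \<noteq> k} \<union>
     {br (F i j a) (F k q b) | i j k q a b.
        {i, j, k, q} \<subseteq> I \<and> i \<noteq> j \<and> j \<noteq> k \<and> k \<noteq> q \<and> q \<noteq> i})"

definition steinberg ::
    "(complex \<Rightarrow> 'a::ring \<Rightarrow> 'a) \<Rightarrow> nat \<Rightarrow> nat \<Rightarrow> 'a st_gen free_alg set superalgebra" where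
  "steinberg sc m n =
     presented_lie (st_gens m n UNIV) (st_parity m) (steinberg_rels sc m n)"

text \<open>The algebra \<open>\<complex>[u, v]\<close> is realised as \<open>\<complex>[u][v]\<close>.\<close>

type_synonym poly_uv = "complex poly poly"

definition var_u :: poly_uv where "var_u = [:[:0, 1:]:]"

definition var_v :: poly_uv where "var_v = [:0, 1:]"

definition scale_uv :: "complex \<Rightarrow> poly_uv \<Rightarrow> poly_uv" where
  "scale_uv c = Polynomial.smult [:c:]"

text \<open>
  The generators of the finite presentation: \<open>F\<close> now takes only the three labels \<open>1\<close>, \<open>u\<close>, \<open>v\<close>
  as its last argument. The expressions \<open>var_u ^ k\<close> and \<open>var_v ^ k\<close> below have \<open>k \<in> {0, 1}\<close>
  and so are such labels.
\<close>

definition steinberg_tilde_rels :: "nat \<Rightarrow> nat \<Rightarrow> poly_uv st_gen free_alg set" where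
  "steinberg_tilde_rels m n = (let I = {1..m+n}; u = var_u; v = var_v in
     {br (F a b x) (F c d y) | a b c d x y.
        {a, b, c, d} \<subseteq> I \<and> a \<noteq> b \<and> b \<noteq> c \<and> c \<noteq> d \<and> d \<noteq> a \<and>
        (x, y) \<in> {(u, u), (u, v), (v, v), (u, 1), (v, 1), (1, 1)}} \<union>
     {br (F a b x) (F b c y) - br (F a d x') (F d c y') | a b c d x y x' y'.
        {a, b, c, d} \<subseteq> I \<and> a \<noteq> b \<and> b \<noteq> c \<and> a \<noteq> c \<and> c \<noteq> d \<and> a \<noteq> d \<and>
        (x, y, x', y') \<in> {(u, u, u, u), (u, v, v, u), (v, v, v, v)}} \<union>
     {br (F a b (w ^ i)) (F b c (w ^ j)) - F a c (w ^ (i + j)) | a b c w i j.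
        {a, b, c} \<subseteq> I \<and> a \<noteq> b \<and> b \<noteq> c \<and> a \<noteq> c \<and>
        w \<in> {u, v} \<and> i + j \<in> {0, 1}})"

definition steinberg_tilde :: "nat \<Rightarrow> nat \<Rightarrow> poly_uv st_gen free_alg set superalgebra" where
  "steinberg_tilde m n =
     presented_lie (st_gens m n {1, var_u, var_v}) (st_parity m) (steinberg_tilde_rels m n)"


section \<open>The presented algebras are Lie superalgebras\<close>

lemma lookup_scale [simp]: "Poly_Mapping.lookup (scale c x) t = c * Poly_Mapping.lookup x t"
  unfolding scale_def by (simp add: Poly_Mapping.map.rep_eq when_def)

lemma lookup_br:
  "Poly_Mapping.lookup (br x y) w =
    (case w of Gen g \<Rightarrow> 0 | Br s t \<Rightarrow> Poly_Mapping.lookup x s * Poly_Mapping.lookup y t)"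
proof -
  have *: "Poly_Mapping.lookup (br x y) w = (\<Sum>s\<in>Poly_Mapping.keys x. \<Sum>t\<in>Poly_Mapping.keys y.
     if w = Br s t then Poly_Mapping.lookup x s * Poly_Mapping.lookup y t else 0)"
    unfolding br_def lookup_sum lookup_single when_def by (intro sum.cong refl) auto
  show ?thesis
  proof (cases w)
    case (Gen g) then show ?thesis unfolding * by simp
  next
    case (Br a b)
    have "Poly_Mapping.lookup (br x y) w = (\<Sum>s\<in>Poly_Mapping.keys x. if s = a then
       (\<Sum>t\<in>Poly_Mapping.keys y. if t = b then Poly_Mapping.lookup x s * Poly_Mapping.lookup y t else 0) else 0)"
      unfolding * unfolding Br by (rule sum.cong[OF refl]) (auto intro!: sum.cong)
    then show ?thesis using Br by (auto simp: sum.delta not_in_keys_iff_lookup_eq_zero)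
  qed
qed

lemma br_add_left: "br (x + y) z = br x z + br y z"
  by (rule poly_mapping_eqI) (auto simp: lookup_br lookup_add algebra_simps split: word.splits)
lemma br_add_right: "br x (y + z) = br x y + br x z"
  by (rule poly_mapping_eqI) (auto simp: lookup_br lookup_add algebra_simps split: word.splits)
lemma br_diff_left: "br (x - y) z = br x z - br y z"
  by (rule poly_mapping_eqI) (auto simp: lookup_br lookup_minus algebra_simps split: word.splits)
lemma br_diff_right: "br x (y - z) = br x y - br x z"
  by (rule poly_mapping_eqI) (auto simp: lookup_br lookup_minus algebra_simps split: word.splits)
lemma br_scale_left: "br (scale c x) y = scale c (br x y)"
  by (rule poly_mapping_eqI) (auto simp: lookup_br split: word.splits)
lemma br_scale_right: "br x (scale c y) = scale c (br x y)"
  by (rule poly_mapping_eqI) (auto simp: lookup_br split: word.splits)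
lemma scale_simps:
  "scale c (x + y) = scale c x + scale c y" "scale (c + d) x = scale c x + scale d x"
  "scale c (x - y) = scale c x - scale c y"
  "scale c (scale d x) = scale (c * d) x" "scale 1 x = x" "scale 0 x = 0" "scale (-1) x = - x"
  "scale c 0 = 0"
  by (rule poly_mapping_eqI; simp add: lookup_add lookup_minus algebra_simps)+

lemma free_carrier_iff: "x \<in> free_carrier G \<longleftrightarrow> (\<forall>t. Poly_Mapping.lookup x t \<noteq> 0 \<longrightarrow> gens t \<subseteq> G)"
  unfolding free_carrier_def by (auto simp: in_keys_iff)
lemma free_part_iff: "x \<in> free_part G p d \<longleftrightarrow>
    (\<forall>t. Poly_Mapping.lookup x t \<noteq> 0 \<longrightarrow> gens t \<subseteq> G \<and> word_parity p t = d)"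
  unfolding free_part_def free_carrier_iff by (auto simp: in_keys_iff)

lemma free_carrier_closed:
  "0 \<in> free_carrier G"
  "x \<in> free_carrier G \<Longrightarrow> y \<in> free_carrier G \<Longrightarrow> x + y \<in> free_carrier G"
  "x \<in> free_carrier G \<Longrightarrow> y \<in> free_carrier G \<Longrightarrow> x - y \<in> free_carrier G"
  "x \<in> free_carrier G \<Longrightarrow> scale c x \<in> free_carrier G"
  "x \<in> free_carrier G \<Longrightarrow> y \<in> free_carrier G \<Longrightarrow> br x y \<in> free_carrier G"
  unfolding free_carrier_iff
      apply simp
     apply (metis add.right_neutral lookup_add)
    apply (metis diff_zero lookup_minus)
   apply simp
  apply (auto simp: lookup_br split: word.splits)
  done

lemma free_part_closed:
  "0 \<in> free_part G p d"
  "x \<in> free_part G p d \<Longrightarrow> y \<in> free_part G p d \<Longrightarrow> x + y \<in> free_part G p d"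
  "x \<in> free_part G p d \<Longrightarrow> y \<in> free_part G p d \<Longrightarrow> x - y \<in> free_part G p d"
  "x \<in> free_part G p d \<Longrightarrow> scale c x \<in> free_part G p d"
  "x \<in> free_part G p d \<Longrightarrow> y \<in> free_part G p e \<Longrightarrow> br x y \<in> free_part G p (d + e)"
  unfolding free_part_iff
      apply simp
     apply (metis add.right_neutral lookup_add)
    apply (metis diff_zero lookup_minus)
   apply simp
  apply (auto simp: lookup_br split: word.splits)
  done

lemma free_part_subset: "x \<in> free_part G p d \<Longrightarrow> x \<in> free_carrier G"
  by (simp add: free_part_def)

lemma gen_in_part: "g \<in> G \<Longrightarrow> d = p g \<Longrightarrow> gen g \<in> free_part G p d"
  unfolding free_part_def free_carrier_def gen_def by auto

definition component :: "('g \<Rightarrow> bit) \<Rightarrow> bit \<Rightarrow> 'g free_alg \<Rightarrow> 'g free_alg" where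
  "component p d x = Poly_Mapping.mapp (\<lambda>t c. if word_parity p t = d then c else 0) x"

lemma lookup_component: "Poly_Mapping.lookup (component p d x) t =
    (if word_parity p t = d then Poly_Mapping.lookup x t else 0)"
  unfolding component_def by (auto simp: lookup_mapp when_def in_keys_iff)

lemma component_part: "x \<in> free_carrier G \<Longrightarrow> component p d x \<in> free_part G p d"
  by (auto simp: free_part_iff free_carrier_iff lookup_component split: if_splits)
lemma component_sum: "x = component p 0 x + component p 1 x"
  by (rule poly_mapping_eqI) (auto simp: lookup_add lookup_component)
lemma component_hom: "x \<in> free_part G p d \<Longrightarrow> component p e x = (if e = d then x else 0)"
  by (rule poly_mapping_eqI) (auto simp: free_part_iff lookup_component)
lemma component_simps:
  "component p d (x + y) = component p d x + component p d y"
  "component p d (scale c x) = scale c (component p d x)"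
  "component p d 0 = 0"
  "component p d (br x y) = br (component p 0 x) (component p d y) + br (component p 1 x) (component p (d + 1) y)"
     apply (rule poly_mapping_eqI; simp add: lookup_add lookup_component)
    apply (rule poly_mapping_eqI; simp add: lookup_add lookup_component)
   apply (rule poly_mapping_eqI; simp add: lookup_add lookup_component)
  apply (rule poly_mapping_eqI)
  apply (auto simp: lookup_add lookup_component lookup_br split: word.splits)
  done


context
  fixes G :: "'g set" and p :: "'g \<Rightarrow> bit" and R :: "'g free_alg set"
  assumes homogeneous: "R \<subseteq> (\<Union>d. free_part G p d)"
begin

lemma lie_ideal_carrier: "x \<in> lie_ideal G p R \<Longrightarrow> x \<in> free_carrier G"
  by (induction rule: lie_ideal.induct)
    (use homogeneous in \<open>auto intro!: free_carrier_closed dest: free_part_subset\<close>)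

lemma lie_ideal_hom:
  "x \<in> lie_ideal G p R \<Longrightarrow> x \<in> free_part G p d \<Longrightarrow> component p e x \<in> lie_ideal G p R"
  by (simp add: component_hom lie_ideal.zero)

lemma lie_ideal_component: "x \<in> lie_ideal G p R \<Longrightarrow> component p d x \<in> lie_ideal G p R"
proof (induction arbitrary: d rule: lie_ideal.induct)
  case (relator r)
  then obtain e where "r \<in> free_part G p e" using homogeneous by auto
  then show ?case by (rule lie_ideal_hom[OF lie_ideal.relator[OF relator]])
next
  case (skew x a y b)
  have "br x y + scale (koszul a b) (br y x) \<in> free_part G p (a + b)"
    using free_part_closed(5)[OF skew] free_part_closed(5)[OF skew(2) skew(1)]
    by (simp only: free_part_closed add.commute)
  then show ?case by (rule lie_ideal_hom[OF lie_ideal.skew[OF skew]])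
next
  case (jacobi x a y b z c)
  have "br y (br x z) \<in> free_part G p (a + (b + c))"
    using free_part_closed(5)[OF jacobi(2) free_part_closed(5)[OF jacobi(1) jacobi(3)]]
    by (metis add.left_commute)
  moreover have "br (br x y) z \<in> free_part G p (a + (b + c))"
    using free_part_closed(5)[OF free_part_closed(5)[OF jacobi(1) jacobi(2)] jacobi(3)]
    by (metis add.assoc)
  ultimately have "br x (br y z) - (br (br x y) z + scale (koszul a b) (br y (br x z)))
      \<in> free_part G p (a + (b + c))"
    using free_part_closed(5)[OF jacobi(1) free_part_closed(5)[OF jacobi(2,3)]]
    by (intro free_part_closed(2-4))
  then show ?case by (rule lie_ideal_hom[OF lie_ideal.jacobi[OF jacobi]])
next
  case (br_left x y)
  then show ?case unfolding component_simps
    by (intro lie_ideal.add lie_ideal.br_left component_part[THEN free_part_subset])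
next
  case (br_right x y)
  then show ?case unfolding component_simps
    by (intro lie_ideal.add lie_ideal.br_right component_part[THEN free_part_subset])
qed (auto simp: component_simps intro!: lie_ideal.zero lie_ideal.add lie_ideal.scale)

lemma lie_ideal_uminus: "x \<in> lie_ideal G p R \<Longrightarrow> - x \<in> lie_ideal G p R"
  using lie_ideal.scale[of x G p R "-1"] by (simp add: scale_simps)

lemma lie_ideal_diff: "x \<in> lie_ideal G p R \<Longrightarrow> y \<in> lie_ideal G p R \<Longrightarrow> x - y \<in> lie_ideal G p R"
  using lie_ideal.add[OF _ lie_ideal_uminus, of x y] by simp

lemma equiv_lie_cong: "equiv (free_carrier G) (lie_cong G p R)"
proof (rule equivI)
  show "sym (lie_cong G p R)"
    unfolding sym_def lie_cong_def using lie_ideal_uminus by force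
  show "trans (lie_cong G p R)"
    unfolding trans_def lie_cong_def using lie_ideal.add by fastforce
qed (auto simp: lie_cong_def refl_on_def lie_ideal.zero)

abbreviation "cls \<equiv> lie_class G p R"

lemma cls_eq_iff: "x \<in> free_carrier G \<Longrightarrow> y \<in> free_carrier G \<Longrightarrow>
    cls x = cls y \<longleftrightarrow> x - y \<in> lie_ideal G p R"
  using eq_equiv_class_iff[OF equiv_lie_cong] unfolding lie_class_def by (simp add: lie_cong_def)

lemma carrier_presented: "carrier (presented_lie G p R) = cls ` free_carrier G"
  by (auto simp: presented_lie_def quotient_def lie_class_def)

lemma part_presented: "part (presented_lie G p R) d = cls ` free_part G p d"
  by (auto simp: presented_lie_def lie_class_def)

lemma zero_presented: "\<zero>\<^bsub>presented_lie G p R\<^esub> = cls 0"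
  by (simp add: presented_lie_def lie_class_def)

lemma add_presented:
  assumes "x \<in> free_carrier G" "y \<in> free_carrier G"
  shows "cls x \<oplus>\<^bsub>presented_lie G p R\<^esub> cls y = cls (x + y)"
proof -
  have "congruent2 (lie_cong G p R) (lie_cong G p R) (\<lambda>x y. cls (x + y))"
  proof (rule congruent2I')
    fix a b c d assume *: "(a, b) \<in> lie_cong G p R" "(c, d) \<in> lie_cong G p R"
    then have "(a - b) + (c - d) \<in> lie_ideal G p R"
      by (intro lie_ideal.add) (auto simp: lie_cong_def)
    then show "cls (a + c) = cls (b + d)"
      using * by (subst cls_eq_iff) (auto simp: lie_cong_def free_carrier_closed algebra_simps)
  qed
  from UN_equiv_class2[OF equiv_lie_cong equiv_lie_cong this assms]
  show ?thesis by (simp add: presented_lie_def lie_class_def)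
qed

lemma br_presented:
  assumes "x \<in> free_carrier G" "y \<in> free_carrier G"
  shows "cls x \<otimes>\<^bsub>presented_lie G p R\<^esub> cls y = cls (br x y)"
proof -
  have "congruent2 (lie_cong G p R) (lie_cong G p R) (\<lambda>x y. cls (br x y))"
  proof (rule congruent2I')
    fix a b c d assume *: "(a, b) \<in> lie_cong G p R" "(c, d) \<in> lie_cong G p R"
    then have "br (a - b) c + br b (c - d) \<in> lie_ideal G p R"
      by (intro lie_ideal.add lie_ideal.br_left lie_ideal.br_right) (auto simp: lie_cong_def)
    then show "cls (br a c) = cls (br b d)"
      using * by (subst cls_eq_iff)
        (auto simp: lie_cong_def free_carrier_closed br_diff_left br_diff_right)
  qed
  from UN_equiv_class2[OF equiv_lie_cong equiv_lie_cong this assms]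
  show ?thesis by (simp add: presented_lie_def lie_class_def)
qed

lemma smult_presented:
  assumes "x \<in> free_carrier G"
  shows "c \<odot>\<^bsub>presented_lie G p R\<^esub> cls x = cls (scale c x)"
proof -
  have "(\<lambda>x. cls (scale c x)) respects lie_cong G p R"
  proof (rule congruentI)
    fix a b assume *: "(a, b) \<in> lie_cong G p R"
    then have "scale c (a - b) \<in> lie_ideal G p R"
      by (intro lie_ideal.scale) (auto simp: lie_cong_def)
    then show "cls (scale c a) = cls (scale c b)"
      using * by (subst cls_eq_iff) (auto simp: lie_cong_def free_carrier_closed scale_simps)
  qed
  from UN_equiv_class[OF equiv_lie_cong this assms]
  show ?thesis by (simp add: presented_lie_def lie_class_def)
qed

lemma lie_superalgebra_presented: "lie_superalgebra (presented_lie G p R)"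
proof -
  let ?L = "presented_lie G p R"
  note simps = add_presented br_presented smult_presented zero_presented free_carrier_closed
  have ring_simps: "carrier complex_field = UNIV" "a \<oplus>\<^bsub>complex_field\<^esub> b = a + b"
    "a \<otimes>\<^bsub>complex_field\<^esub> b = a * b" "\<one>\<^bsub>complex_field\<^esub> = 1" for a b
    by (auto simp: ring_of_type_algebra_def)
  have ab: "abelian_group ?L"
  proof (rule abelian_groupI)
    show "\<exists>y\<in>carrier ?L. y \<oplus>\<^bsub>?L\<^esub> x = \<zero>\<^bsub>?L\<^esub>" if "x \<in> carrier ?L" for x
    proof -
      from that obtain a where a: "a \<in> free_carrier G" "x = cls a" by (auto simp: carrier_presented)
      have "cls (scale (-1) a) \<oplus>\<^bsub>?L\<^esub> x = \<zero>\<^bsub>?L\<^esub>" using a by (simp add: simps) (simp add: scale_simps)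
      then show ?thesis using a by (auto simp: carrier_presented simps)
    qed
  qed (auto simp: carrier_presented simps ac_simps)
  have mod: "module complex_field ?L"
    by (rule moduleI[OF cring_from_type_algebra ab])
      (auto simp: carrier_presented simps ring_simps; simp add: scale_simps)+
  interpret M: module complex_field ?L by (rule mod)
  have part_carrier: "part ?L d \<subseteq> carrier ?L" for d
    by (auto simp: part_presented carrier_presented dest: free_part_subset)
  have uminus_cls: "\<ominus>\<^bsub>?L\<^esub> cls x = cls (- x)" if "x \<in> free_carrier G" for x
  proof -
    have "- x \<in> free_carrier G"
      using free_carrier_closed(4)[OF that, of "-1"] by (simp add: scale_simps)
    then have "cls (- x) \<in> carrier ?L" "cls (- x) \<oplus>\<^bsub>?L\<^esub> cls x = \<zero>\<^bsub>?L\<^esub>" "cls x \<in> carrier ?L"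
      using that by (simp_all add: simps carrier_presented)
    then show ?thesis by (metis M.M.minus_equality)
  qed
  have disjoint: "x = \<zero>\<^bsub>?L\<^esub>" if "x \<in> part ?L 0" "x \<in> part ?L 1" for x
  proof -
    from that obtain a b where *: "a \<in> free_part G p 0" "x = cls a" "b \<in> free_part G p 1" "x = cls b"
      by (auto simp: part_presented)
    then have "a - b \<in> lie_ideal G p R" using cls_eq_iff by (metis free_part_subset)
    then have "component p 0 (a - b) \<in> lie_ideal G p R" by (rule lie_ideal_component)
    moreover have "component p 0 (a - b) = a"
      using * by (intro poly_mapping_eqI) (auto simp: lookup_component lookup_minus free_part_iff)
    ultimately show ?thesis
      using * cls_eq_iff[of a 0] by (simp add: zero_presented free_part_subset free_carrier_closed)
  qed
  show ?thesis
  proof (intro lie_superalgebra.intro lie_superalgebra_axioms.intro mod)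
    show "submodule (part ?L d) complex_field ?L" for d
    proof (rule M.submoduleI[OF part_carrier])
      show "\<ominus>\<^bsub>?L\<^esub> a \<in> part ?L d" if "a \<in> part ?L d" for a
      proof -
        from that obtain x where x: "x \<in> free_part G p d" "a = cls x" by (auto simp: part_presented)
        then show ?thesis
          using free_part_closed(4)[OF x(1), of "-1"]
          by (simp add: uminus_cls[OF free_part_subset] part_presented scale_simps)
      qed
    qed (auto simp: part_presented simps free_part_subset intro!: imageI free_part_closed)
  next
    show "\<exists>y\<in>part ?L 0. \<exists>z\<in>part ?L 1. x = y \<oplus>\<^bsub>?L\<^esub> z" if "x \<in> carrier ?L" for x
    proof -
      from that obtain a where a: "a \<in> free_carrier G" "x = cls a" by (auto simp: carrier_presented)
      then have "x = cls (component p 0 a) \<oplus>\<^bsub>?L\<^esub> cls (component p 1 a)"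
        using component_sum[of a p] by (simp add: simps component_part[THEN free_part_subset])
      then show ?thesis using a component_part by (fastforce simp: part_presented)
    qed
  next
    show "part ?L 0 \<inter> part ?L 1 = {\<zero>\<^bsub>?L\<^esub>}"
      using disjoint by (auto simp: part_presented zero_presented intro!: imageI free_part_closed)
  next
    fix x y d e assume "x \<in> part ?L d" "y \<in> part ?L e"
    then show "x \<otimes>\<^bsub>?L\<^esub> y \<in> part ?L (d + e)"
      by (clarsimp simp: part_presented simps free_part_subset simp del: add_bit_eq_xor)
        (rule imageI, rule free_part_closed(5))
  next
    fix x y d e assume "x \<in> part ?L d" "y \<in> part ?L e"
    then obtain a b where *: "a \<in> free_part G p d" "x = cls a" "b \<in> free_part G p e" "y = cls b"
      by (auto simp: part_presented)
    then have "br a b + scale (koszul d e) (br b a) - 0 \<in> lie_ideal G p R"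
      using lie_ideal.skew by fastforce
    then have "cls (br a b + scale (koszul d e) (br b a)) = cls 0"
      using * by (subst cls_eq_iff) (auto simp: simps free_part_subset)
    then show "x \<otimes>\<^bsub>?L\<^esub> y \<oplus>\<^bsub>?L\<^esub> koszul d e \<odot>\<^bsub>?L\<^esub> (y \<otimes>\<^bsub>?L\<^esub> x) = \<zero>\<^bsub>?L\<^esub>"
      using * by (simp add: simps free_part_subset)
  next
    fix x y z d e f assume "x \<in> part ?L d" "y \<in> part ?L e" "z \<in> part ?L f"
    then obtain a b c where *: "a \<in> free_part G p d" "x = cls a" "b \<in> free_part G p e" "y = cls b"
      "c \<in> free_part G p f" "z = cls c"
      by (auto simp: part_presented)
    then have "br a (br b c) - (br (br a b) c + scale (koszul d e) (br b (br a c))) \<in> lie_ideal G p R"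
      by (intro lie_ideal.jacobi)
    then have "cls (br a (br b c)) = cls (br (br a b) c + scale (koszul d e) (br b (br a c)))"
      using * by (subst cls_eq_iff) (auto simp: simps free_part_subset)
    then show "x \<otimes>\<^bsub>?L\<^esub> (y \<otimes>\<^bsub>?L\<^esub> z) =
        (x \<otimes>\<^bsub>?L\<^esub> y) \<otimes>\<^bsub>?L\<^esub> z \<oplus>\<^bsub>?L\<^esub> koszul d e \<odot>\<^bsub>?L\<^esub> (y \<otimes>\<^bsub>?L\<^esub> (x \<otimes>\<^bsub>?L\<^esub> z))"
      using * by (simp add: simps free_part_subset)
  qed (auto simp: carrier_presented part_presented simps free_part_subset
      br_add_left br_add_right br_scale_left br_scale_right intro!: imageI free_part_closed)
qed

end

lemma F_in_part:
  "i \<in> {1..m+n} \<Longrightarrow> j \<in> {1..m+n} \<Longrightarrow> i \<noteq> j \<Longrightarrow> a \<in> S \<Longrightarrow>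
    F i j a \<in> free_part (st_gens m n S) (st_parity m) (index_parity m i + index_parity m j)"
  by (rule gen_in_part) (auto simp: st_gens_def st_parity_def)

lemma br_F_in_part:
  assumes "i \<in> {1..m+n}" "j \<in> {1..m+n}" "i \<noteq> j" "a \<in> S"
    "k \<in> {1..m+n}" "j \<noteq> k" "b \<in> S"
  shows "br (F i j a) (F j k b) \<in>
    free_part (st_gens m n S) (st_parity m) (index_parity m i + index_parity m k)"
proof -
  have "index_parity m i + index_parity m j + (index_parity m j + index_parity m k) =
      index_parity m i + index_parity m k"
    by (simp add: index_parity_def)
  with free_part_closed(5)[OF F_in_part[OF assms(1-4)] F_in_part[OF assms(2,5-7)]]
  show ?thesis by metis
qed

lemma lie_superalgebra_steinberg: "lie_superalgebra (steinberg sc m n)"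
  unfolding steinberg_def
proof (rule lie_superalgebra_presented, rule subsetI)
  let ?P = "free_part (st_gens m n UNIV) (st_parity m)"
  fix r assume "r \<in> steinberg_rels sc m n"
  then have "\<exists>d. r \<in> ?P d"
    unfolding steinberg_rels_def Let_def
  proof (elim UnE CollectE exE conjE, goal_cases)
    case (1 i j a b)
    show ?case unfolding 1(1)
      by (rule exI[of _ "index_parity m i + index_parity m j"], intro free_part_closed F_in_part)
        (use 1 in auto)
  next
    case (2 i j a c)
    show ?case unfolding 2(1)
      by (rule exI[of _ "index_parity m i + index_parity m j"], intro free_part_closed F_in_part)
        (use 2 in auto)
  next
    case (3 i j k a b)
    show ?case unfolding 3(1)
      by (rule exI[of _ "index_parity m i + index_parity m k"],
          intro free_part_closed(3) br_F_in_part F_in_part) (use 3 in auto)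
  next
    case (4 i j k q a b)
    show ?case unfolding 4(1)
      by (rule exI, rule free_part_closed(5)[OF F_in_part F_in_part]) (use 4 in auto)
  qed
  then show "r \<in> (\<Union>d. ?P d)" by blast
qed

lemma lie_superalgebra_steinberg_tilde: "lie_superalgebra (steinberg_tilde m n)"
  unfolding steinberg_tilde_def
proof (rule lie_superalgebra_presented, rule subsetI)
  let ?S = "{1, var_u, var_v}"
  let ?P = "free_part (st_gens m n ?S) (st_parity m)"
  have pow: "w ^ k \<in> ?S" if "w \<in> {var_u, var_v}" "k \<le> 1" for w k
    using that by (cases k) auto
  fix r assume "r \<in> steinberg_tilde_rels m n"
  then have "\<exists>d. r \<in> ?P d"
    unfolding steinberg_tilde_rels_def Let_def
  proof (elim UnE CollectE exE conjE, goal_cases)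
    case (1 a b c d x y)
    then have "x \<in> ?S" "y \<in> ?S" by auto
    with 1 show ?case unfolding 1(1)
      by - (rule exI, rule free_part_closed(5)[OF F_in_part F_in_part], simp_all)
  next
    case (2 a b c d x y x' y')
    then have "x \<in> ?S" "y \<in> ?S" "x' \<in> ?S" "y' \<in> ?S" by auto
    with 2 show ?case unfolding 2(1)
      by (intro exI[of _ "index_parity m a + index_parity m c"] free_part_closed(3) br_F_in_part)
        simp_all
  next
    case (3 a b c w i j)
    then show ?case unfolding 3(1)
      by (intro exI[of _ "index_parity m a + index_parity m c"] free_part_closed(3) br_F_in_part
          F_in_part pow) auto
  qed
  then show "r \<in> (\<Union>d. ?P d)" by blast
qed

end

(*
The generator F_ab(u^i v^j) is represented in the finitely presented algebra by an iterated
bracket mon_F of the given generators. By induction on the total degree, these elements satisfy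
the Steinberg relations. With a fifth index e, write the factor of degree at least 2 as
[F_ae(s), F_eb(t)] with s, t of positive degree: both factors commute with F_cd(q) in smaller
total degree. Commutation in turn removes one of the three terms of the Jacobi identity, so
[F_ab(p), F_bc(q)] does not depend on b and satisfies f(pq, r) = f(p, qr); together with the
quadratic relation for uv = vu, it depends on the product monomial only. Extending linearly gives
the inverse of the obvious homomorphism between the two algebras.
*)
theory Submission
  imports Defs "HOL-Library.Product_Plus"
begin

section \<open>Presentations of Lie superalgebras\<close>

locale presentation =
  fixes G :: "'g set" and p :: "'g \<Rightarrow> bit" and R :: "'g free_alg set"
  assumes homogeneous: "R \<subseteq> (\<Union>d. free_part G p d)"
begin

definition lie_eq :: "'g free_alg \<Rightarrow> 'g free_alg \<Rightarrow> bool" (infix "\<approx>" 50) where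
  "x \<approx> y \<longleftrightarrow> (x, y) \<in> lie_cong G p R"

lemma lie_eqI: "\<lbrakk>x \<in> free_carrier G; y \<in> free_carrier G; x - y \<in> lie_ideal G p R\<rbrakk> \<Longrightarrow> x \<approx> y"
  by (simp add: lie_eq_def lie_cong_def)

lemma lie_eqD:
  assumes "x \<approx> y"
  shows "x \<in> free_carrier G" "y \<in> free_carrier G" "x - y \<in> lie_ideal G p R"
  using assms by (simp_all add: lie_eq_def lie_cong_def)

lemma lie_eq_refl: "x \<in> free_carrier G \<Longrightarrow> x \<approx> x"
  by (simp add: lie_eq_def lie_cong_def lie_ideal.zero)

lemma lie_eq_sym: "x \<approx> y \<Longrightarrow> y \<approx> x"
  using equiv_lie_cong[OF homogeneous] unfolding lie_eq_def by (meson equivE symE)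

lemma lie_eq_trans [trans]: "x \<approx> y \<Longrightarrow> y \<approx> z \<Longrightarrow> x \<approx> z"
  using equiv_lie_cong[OF homogeneous] unfolding lie_eq_def by (meson equivE transE)

lemma lie_eq_zero_iff: "x \<approx> 0 \<longleftrightarrow> x \<in> lie_ideal G p R"
  using lie_ideal_carrier[OF homogeneous] by (auto simp: lie_eq_def lie_cong_def free_carrier_closed)

lemma lie_eq_iff_diff:
  "x \<in> free_carrier G \<Longrightarrow> y \<in> free_carrier G \<Longrightarrow> x \<approx> y \<longleftrightarrow> x - y \<approx> 0"
  by (simp add: lie_eq_def lie_cong_def free_carrier_closed)

lemma lie_eq_add: "x \<approx> y \<Longrightarrow> x' \<approx> y' \<Longrightarrow> x + x' \<approx> y + y'"
  using lie_ideal.add[of "x - y" G p R "x' - y'"]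
  by (auto simp: lie_eq_def lie_cong_def free_carrier_closed algebra_simps)

lemma lie_eq_diff: "x \<approx> y \<Longrightarrow> x' \<approx> y' \<Longrightarrow> x - x' \<approx> y - y'"
  using lie_ideal_diff[OF homogeneous, of "x - y" "x' - y'"]
  by (auto simp: lie_eq_def lie_cong_def free_carrier_closed algebra_simps)

lemma lie_eq_scale: "x \<approx> y \<Longrightarrow> scale c x \<approx> scale c y"
  using lie_ideal.scale[of "x - y" G p R c]
  by (auto simp: lie_eq_def lie_cong_def free_carrier_closed scale_simps)

lemma lie_eq_br: "x \<approx> y \<Longrightarrow> x' \<approx> y' \<Longrightarrow> br x x' \<approx> br y y'"
  using lie_ideal.add[OF lie_ideal.br_right[of "x - y" G p R x']
      lie_ideal.br_left[of "x' - y'" G p R y]]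
  by (auto simp: lie_eq_def lie_cong_def free_carrier_closed br_diff_left br_diff_right)

lemma br_zero_right: "x \<in> free_carrier G \<Longrightarrow> y \<approx> 0 \<Longrightarrow> br x y \<approx> 0"
  by (simp add: lie_eq_zero_iff lie_ideal.br_left)

lemma br_assoc:
  assumes "x \<in> free_part G p d" "y \<in> free_part G p e" "z \<in> free_part G p f" "br x z \<approx> 0"
  shows "br x (br y z) \<approx> br (br x y) z"
proof -
  have "scale (koszul d e) (br y (br x z)) \<in> lie_ideal G p R"
    using assms by (simp add: lie_eq_zero_iff lie_ideal.scale lie_ideal.br_left free_part_subset)
  from lie_ideal.add[OF lie_ideal.jacobi[OF assms(1-3)] this]
  show ?thesis
    by (intro lie_eqI) (simp_all add: assms(1-3)[THEN free_part_subset] free_carrier_closed)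
qed

lemma br_zero_commute:
  assumes "x \<in> free_part G p d" "y \<in> free_part G p e" "br x y \<approx> 0"
  shows "br y x \<approx> 0"
proof -
  have "br y x + scale (koszul e d) (br x y) - scale (koszul e d) (br x y) \<in> lie_ideal G p R"
    using assms lie_ideal_diff[OF homogeneous] lie_ideal.skew lie_ideal.scale
    by (metis lie_eq_zero_iff)
  then show ?thesis by (simp add: lie_eq_zero_iff)
qed

lemma br_br_zero:
  assumes "x \<in> free_part G p d" "y \<in> free_part G p e" "z \<in> free_part G p f"
    and "br x z \<approx> 0" "br y z \<approx> 0" and w: "w \<approx> br x y"
  shows "br w z \<approx> 0"
proof -
  have "br w z \<approx> br (br x y) z"
    using w lie_eq_refl assms(3) free_part_subset by (blast intro: lie_eq_br)
  also have "br (br x y) z \<approx> br x (br y z)"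
    using br_assoc[OF assms(1-4)] by (rule lie_eq_sym)
  also have "br x (br y z) \<approx> 0"
    using assms free_part_subset by (blast intro: br_zero_right)
  finally show ?thesis .
qed

end

primrec word_eval :: "('g \<Rightarrow> 'h free_alg) \<Rightarrow> 'g word \<Rightarrow> 'h free_alg" where
  "word_eval h (Gen g) = h g"
| "word_eval h (Br s t) = br (word_eval h s) (word_eval h t)"

definition lift :: "('g \<Rightarrow> 'h free_alg) \<Rightarrow> 'g free_alg \<Rightarrow> 'h free_alg" where
  "lift h x = (\<Sum>t\<in>Poly_Mapping.keys x. scale (Poly_Mapping.lookup x t) (word_eval h t))"

lemma scale_sum: "scale c (sum f A) = (\<Sum>i\<in>A. scale c (f i))"
  by (induction A rule: infinite_finite_induct) (simp_all add: scale_simps)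

lemma br_sum_left: "br (sum f A) y = (\<Sum>i\<in>A. br (f i) y)"
proof -
  have "br 0 y = 0" using br_diff_left[of 0 0 y] by simp
  then show ?thesis by (induction A rule: infinite_finite_induct) (simp_all add: br_add_left)
qed

lemma br_sum_right: "br x (sum f A) = (\<Sum>i\<in>A. br x (f i))"
proof -
  have "br x 0 = 0" using br_diff_right[of x 0 0] by simp
  then show ?thesis by (induction A rule: infinite_finite_induct) (simp_all add: br_add_right)
qed

lemma free_part_sum: "(\<And>i. i \<in> A \<Longrightarrow> f i \<in> free_part G p d) \<Longrightarrow> sum f A \<in> free_part G p d"
  by (induction A rule: infinite_finite_induct) (simp_all add: free_part_closed)

lemma lift_superset:
  "finite S \<Longrightarrow> Poly_Mapping.keys x \<subseteq> S \<Longrightarrow>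
    lift h x = (\<Sum>t\<in>S. scale (Poly_Mapping.lookup x t) (word_eval h t))"
  unfolding lift_def by (intro sum.mono_neutral_left) (auto simp: in_keys_iff scale_simps)

lemma lift_add: "lift h (x + y) = lift h x + lift h y"
proof -
  let ?S = "Poly_Mapping.keys x \<union> Poly_Mapping.keys y"
  have "finite ?S" "Poly_Mapping.keys (x + y) \<subseteq> ?S"
    using Poly_Mapping.keys_add[of x y] by auto
  then show ?thesis
    by (simp add: lift_superset[of ?S] lookup_add scale_simps sum.distrib)
qed

lemma lift_scale: "lift h (scale c x) = scale c (lift h x)"
proof -
  have "Poly_Mapping.keys (scale c x) \<subseteq> Poly_Mapping.keys x" by (auto simp: in_keys_iff)
  then have "lift h (scale c x) =
      (\<Sum>t\<in>Poly_Mapping.keys x. scale (c * Poly_Mapping.lookup x t) (word_eval h t))"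
    by (subst lift_superset[of "Poly_Mapping.keys x"]) simp_all
  then show ?thesis by (simp add: lift_def scale_sum scale_simps)
qed

lemma lift_zero [simp]: "lift h 0 = 0"
  by (simp add: lift_def)

lemma lift_diff: "lift h (x - y) = lift h x - lift h y"
  using lift_add[of h "x - y" y] by simp

lemma lift_sum: "lift h (sum f A) = (\<Sum>i\<in>A. lift h (f i))"
  by (induction A rule: infinite_finite_induct) (simp_all add: lift_add)

lemma lift_single: "lift h (Poly_Mapping.single t c) = scale c (word_eval h t)"
  by (cases "c = 0") (simp_all add: lift_def scale_simps)

lemma lift_gen [simp]: "lift h (gen g) = h g"
  by (simp add: gen_def lift_single scale_simps)

lemma lift_br: "lift h (br x y) = br (lift h x) (lift h y)"
proof -
  have "lift h (br x y) = (\<Sum>s\<in>Poly_Mapping.keys x. \<Sum>t\<in>Poly_Mapping.keys y.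
      scale (Poly_Mapping.lookup x s * Poly_Mapping.lookup y t) (br (word_eval h s) (word_eval h t)))"
    by (simp add: br_def lift_sum lift_single)
  also have "\<dots> = br (lift h x) (lift h y)"
    unfolding lift_def br_sum_left unfolding br_sum_right
    by (simp add: br_scale_left br_scale_right scale_simps mult.commute)
  finally show ?thesis .
qed

lemmas lift_simps = lift_add lift_diff lift_scale lift_br

lemma free_alg_sum_single:
  "x = (\<Sum>t\<in>Poly_Mapping.keys x. scale (Poly_Mapping.lookup x t) (Poly_Mapping.single t 1))"
  by (rule poly_mapping_eqI) (simp add: lookup_sum lookup_single when_def in_keys_iff
      if_distrib[of "(*) _"] cong: if_cong)

lemma lift_gen_id [simp]: "lift gen x = x"
proof -
  have "word_eval gen t = Poly_Mapping.single t 1" for t :: "'a word"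
    by (induction t) (simp_all add: gen_def br_def)
  then show ?thesis using free_alg_sum_single[of x] by (simp add: lift_def)
qed

lemma lift_lift: "lift k (lift h x) = lift (\<lambda>g. lift k (h g)) x"
proof -
  have "lift k (word_eval h t) = word_eval (\<lambda>g. lift k (h g)) t" for t
    by (induction t) (simp_all add: lift_br)
  then show ?thesis by (simp add: lift_def[of h] lift_def[of "\<lambda>g. lift k (h g)"] lift_sum lift_scale)
qed

lemma lift_part:
  assumes "\<And>g. g \<in> G \<Longrightarrow> h g \<in> free_part G' p' (p g)" "x \<in> free_part G p d"
  shows "lift h x \<in> free_part G' p' d"
proof -
  have word: "gens t \<subseteq> G \<Longrightarrow> word_eval h t \<in> free_part G' p' (word_parity p t)" for t
    by (induction t) (simp_all add: assms(1) free_part_closed(5) del: add_bit_eq_xor)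
  show ?thesis
    unfolding lift_def
  proof (intro free_part_sum free_part_closed(4))
    fix t assume "t \<in> Poly_Mapping.keys x"
    then have "gens t \<subseteq> G" "word_parity p t = d"
      using assms(2) by (auto simp: free_part_def free_carrier_def)
    then show "word_eval h t \<in> free_part G' p' d" using word by blast
  qed
qed

lemma lift_carrier:
  assumes "\<And>g. g \<in> G \<Longrightarrow> h g \<in> free_part G' p' (p g)" "x \<in> free_carrier G"
  shows "lift h x \<in> free_carrier G'"
proof -
  have "lift h (component p d x) \<in> free_carrier G'" for d
    using lift_part[OF assms(1) component_part[OF assms(2)]] by (rule free_part_subset)
  moreover have "lift h x = lift h (component p 0 x) + lift h (component p 1 x)"
    using component_sum[of x p] by (metis lift_add)
  ultimately show ?thesis by (simp only: free_carrier_closed(2))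
qed

lemma lift_lie_ideal:
  assumes part: "\<And>g. g \<in> G \<Longrightarrow> h g \<in> free_part G' p' (p g)"
    and rels: "\<And>r. r \<in> R \<Longrightarrow> lift h r \<in> lie_ideal G' p' R'"
    and "x \<in> lie_ideal G p R"
  shows "lift h x \<in> lie_ideal G' p' R'"
  using assms(3)
  by induction
    (auto simp: lift_simps intro: rels lie_ideal.intros lift_part[OF part] lift_carrier[OF part])

lemma (in presentation) lift_lie_eq_self:
  assumes "\<And>g. g \<in> G \<Longrightarrow> h g \<approx> gen g" and "x \<in> free_carrier G"
  shows "lift h x \<approx> x"
proof -
  have word: "gens t \<subseteq> G \<Longrightarrow> word_eval h t \<approx> word_eval gen t" for t
    by (induction t) (simp_all add: assms(1) lie_eq_br)
  have "lie_eq (\<Sum>t\<in>A. scale (c t) (word_eval h t)) (\<Sum>t\<in>A. scale (c t) (word_eval gen t))"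
    if "finite A" "\<forall>t\<in>A. gens t \<subseteq> G" for A c
    using that
    by induction (simp_all add: word lie_eq_add lie_eq_scale lie_eq_refl free_carrier_closed)
  from this[of "Poly_Mapping.keys x" "Poly_Mapping.lookup x"] assms(2)
  have "lift h x \<approx> lift gen x"
    by (simp add: lift_def free_carrier_def)
  then show ?thesis by simp
qed

lemma lie_super_isomorphic_presented:
  assumes "presentation G p R" "presentation G' p' R'"
    and part: "\<And>g. g \<in> G \<Longrightarrow> h g \<in> free_part G' p' (p g)"
    and part': "\<And>g. g \<in> G' \<Longrightarrow> h' g \<in> free_part G p (p' g)"
    and rels: "\<And>r. r \<in> R \<Longrightarrow> lift h r \<in> lie_ideal G' p' R'"
    and rels': "\<And>r. r \<in> R' \<Longrightarrow> lift h' r \<in> lie_ideal G p R"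
    and inv: "\<And>g. g \<in> G \<Longrightarrow> lift h' (h g) - gen g \<in> lie_ideal G p R"
    and inv': "\<And>g. g \<in> G' \<Longrightarrow> lift h (h' g) - gen g \<in> lie_ideal G' p' R'"
  shows "lie_super_isomorphic (presented_lie G p R) (presented_lie G' p' R')"
proof -
  interpret A: presentation G p R by fact
  interpret B: presentation G' p' R' by fact
  let ?L = "presented_lie G p R" and ?M = "presented_lie G' p' R'"
  let ?c = "lie_class G p R" and ?c' = "lie_class G' p' R'"
  note simps = add_presented br_presented smult_presented carrier_presented part_presented
  note simps = simps[OF A.homogeneous] simps[OF B.homogeneous]
  note carrier = lift_carrier[of G h, OF part] lift_carrier[of G' h', OF part']
  have gen_carrier: "g \<in> H \<Longrightarrow> gen g \<in> free_carrier H" for g and H :: "'x set"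
    by (rule free_part_subset[OF gen_in_part[OF _ refl]])
  have inverse: "lift h' (lift h x) - x \<in> lie_ideal G p R" if "x \<in> free_carrier G" for x
    unfolding lift_lift
    by (rule A.lie_eqD(3)[OF A.lift_lie_eq_self[OF A.lie_eqI that]])
      (simp_all add: inv gen_carrier carrier part[THEN free_part_subset])
  have inverse': "lift h (lift h' x) - x \<in> lie_ideal G' p' R'" if "x \<in> free_carrier G'" for x
    unfolding lift_lift
    by (rule B.lie_eqD(3)[OF B.lift_lie_eq_self[OF B.lie_eqI that]])
      (simp_all add: inv' gen_carrier carrier part'[THEN free_part_subset])
  have cong: "?c' (lift h x) = ?c' (lift h y) \<longleftrightarrow> ?c x = ?c y"
    if "x \<in> free_carrier G" "y \<in> free_carrier G" for x y
  proof -
    note diff = free_carrier_closed(3)[OF that]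
    have "lift h (x - y) \<in> lie_ideal G' p' R' \<longleftrightarrow> x - y \<in> lie_ideal G p R"
    proof
      assume "lift h (x - y) \<in> lie_ideal G' p' R'"
      from lie_ideal_diff[OF A.homogeneous lift_lie_ideal[of G' h', OF part' rels' this] inverse[OF diff]]
      show "x - y \<in> lie_ideal G p R" by simp
    qed (rule lift_lie_ideal[of G h, OF part rels])
    then show ?thesis
      using that by (simp add: cls_eq_iff[OF A.homogeneous] cls_eq_iff[OF B.homogeneous]
          carrier flip: lift_diff)
  qed
  define f where "f A = ?c' (lift h (SOME x. x \<in> free_carrier G \<and> ?c x = A))" for A
  have f: "f (?c x) = ?c' (lift h x)" if "x \<in> free_carrier G" for x
    using someI_ex[of "\<lambda>y. y \<in> free_carrier G \<and> ?c y = ?c x"] that cong unfolding f_def by blast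
  have "f \<in> lie_super_hom ?L ?M"
    unfolding lie_super_hom_def
    using lift_part[of G h, OF part]
    by (auto simp: simps f carrier free_carrier_closed lift_simps free_part_subset)
  moreover have "bij_betw f (carrier ?L) (carrier ?M)"
  proof (rule bij_betwI')
    show "\<exists>A\<in>carrier ?L. B = f A" if "B \<in> carrier ?M" for B
    proof -
      from that obtain x where x: "x \<in> free_carrier G'" "B = ?c' x" by (auto simp: simps)
      then have "B = f (?c (lift h' x))"
        using inverse' by (simp add: f carrier cls_eq_iff[OF B.homogeneous, THEN iffD2, symmetric])
      then show ?thesis using x carrier by (auto simp: simps)
    qed
  qed (auto simp: simps f carrier cong)
  ultimately show ?thesis unfolding lie_super_isomorphic_def lie_super_iso_def by blast
qed

section \<open>Products of monomials\<close>

abbreviation deg :: "nat \<times> nat \<Rightarrow> nat" where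
  "deg p \<equiv> fst p + snd p"

lemma deg_eq_1_iff: "deg p = 1 \<longleftrightarrow> p = (1, 0) \<or> p = (0, 1)"
  by (cases p) auto

lemma deg_ge_1_iff: "deg p \<ge> 1 \<longleftrightarrow> p \<noteq> 0"
  by (cases p) (auto simp: zero_prod_def)

lemma deg_sum_cases:
  assumes "deg p + deg q = K"
  obtains "deg p \<ge> 1" "deg q \<ge> 1" | "p = 0" "deg q = K" | "q = 0" "deg p = K"
proof -
  have "p \<noteq> 0 \<and> q \<noteq> 0 \<or> p = 0 \<and> deg q = K \<or> q = 0 \<and> deg p = K"
    using assms by auto
  then show ?thesis using that deg_ge_1_iff by blast
qed

lemma deg_le_1: "deg p \<le> 1 \<Longrightarrow> p = 0 \<or> p = (1, 0) \<or> p = (0, 1)"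
  by (cases p) (auto simp: zero_prod_def)

lemma deg_split:
  assumes "deg r \<ge> 2"
  obtains s t where "r = s + t" "deg s = 1" "deg t \<ge> 1" "s = (1, 0) \<or> s = (0, 1) \<and> fst t = 0"
proof (cases "fst r")
  case 0
  then show ?thesis using assms that[of "(0, 1)" "(0, snd r - 1)"] by (cases r) auto
next
  case (Suc i)
  then show ?thesis using assms that[of "(1, 0)" "(i, snd r)"] by (cases r) auto
qed

lemma deg_add: "deg (p + q) = deg p + deg q"
  by simp

locale monomial_family = presentation G gp R
  for G :: "'g set" and gp R +
  fixes I :: "'i set" and par :: "'i \<Rightarrow> 'i \<Rightarrow> bit"
    and Y :: "'i \<Rightarrow> 'i \<Rightarrow> nat \<times> nat \<Rightarrow> 'g free_alg"
  assumes fresh_index: "\<exists>e\<in>I. e \<notin> {a, b, c, d}"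
    and Y_part: "\<lbrakk>a \<in> I; b \<in> I; a \<noteq> b\<rbrakk> \<Longrightarrow> Y a b q \<in> free_part G gp (par a b)"
    and Y_split: "\<lbrakk>a \<in> I; b \<in> I; a \<noteq> b; deg r \<ge> 2\<rbrakk> \<Longrightarrow>
      \<exists>e\<in>I - {a, b}. \<exists>s t. r = s + t \<and> deg s = 1 \<and> deg t \<ge> 1 \<and> Y a b r = br (Y a e s) (Y e b t)"
    and gens_commute: "\<lbrakk>{a, b, c, d} \<subseteq> I; a \<noteq> b; b \<noteq> c; c \<noteq> d; d \<noteq> a; deg q \<le> 1; deg r \<le> 1\<rbrakk> \<Longrightarrow>
      lie_eq (br (Y a b q) (Y c d r)) 0"
    and gens_product: "\<lbrakk>{a, b, c} \<subseteq> I; a \<noteq> b; b \<noteq> c; a \<noteq> c; deg q + deg r \<le> 1\<rbrakk> \<Longrightarrow>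
      lie_eq (br (Y a b q) (Y b c r)) (Y a c (q + r))"
    and gens_product_indep: "\<lbrakk>{a, b, c, d} \<subseteq> I; a \<noteq> b; b \<noteq> c; a \<noteq> c; c \<noteq> d; a \<noteq> d;
      deg q = 1; deg r = 1; deg s = 1; deg t = 1; q + r = s + t\<rbrakk> \<Longrightarrow>
      lie_eq (br (Y a b q) (Y b c r)) (br (Y a d s) (Y d c t))"
begin

notation lie_eq (infix "\<approx>" 50)

lemmas Y_refl = Y_part[THEN free_part_subset, THEN lie_eq_refl]

context
  fixes K :: nat
  assumes K: "K \<ge> 2"
    and lower_product: "\<And>a b c p q. \<lbrakk>{a, b, c} \<subseteq> I; a \<noteq> b; b \<noteq> c; a \<noteq> c; deg p + deg q < K\<rbrakk> \<Longrightarrow>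
      br (Y a b p) (Y b c q) \<approx> Y a c (p + q)"
    and lower_commute: "\<And>a b c d p q. \<lbrakk>{a, b, c, d} \<subseteq> I; a \<noteq> b; b \<noteq> c; c \<noteq> d; d \<noteq> a;
      deg p + deg q < K\<rbrakk> \<Longrightarrow> br (Y a b p) (Y c d q) \<approx> 0"
begin

text \<open>The fifth index \<open>e\<close> makes both factors of \<open>Y a b (s + t)\<close> commute with \<open>Y c d q\<close>.\<close>

lemma split_commute:
  assumes "{a, b, c, d} \<subseteq> I" "a \<noteq> b" "b \<noteq> c" "c \<noteq> d" "d \<noteq> a"
    and "deg s + deg q < K" "deg t + deg q < K"
    and eq: "\<And>e. e \<in> I \<Longrightarrow> e \<noteq> a \<Longrightarrow> e \<noteq> b \<Longrightarrow>
      Y a b (s + t) \<approx> br (Y a e s) (Y e b t)"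
  shows "br (Y a b (s + t)) (Y c d q) \<approx> 0"
proof -
  obtain e where e: "e \<in> I" "e \<notin> {a, b, c, d}" using fresh_index by blast
  have "br (Y a e s) (Y c d q) \<approx> 0" "br (Y e b t) (Y c d q) \<approx> 0"
    by (rule lower_commute; use assms e in auto)+
  from br_br_zero[OF Y_part Y_part Y_part this eq] show ?thesis
    using assms e by blast
qed

lemma inner_commute:
  assumes "{a, b, c, d} \<subseteq> I" "a \<noteq> b" "b \<noteq> c" "c \<noteq> d" "d \<noteq> a"
    and "deg p \<ge> 1" "deg q \<ge> 1" "deg p + deg q = K"
  shows "br (Y a b p) (Y c d q) \<approx> 0"
proof -
  have *: "br (Y a b p) (Y c d q) \<approx> 0"
    if "{a, b, c, d} \<subseteq> I" "a \<noteq> b" "b \<noteq> c" "c \<noteq> d" "d \<noteq> a"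
      "deg p \<ge> 2" "deg q \<ge> 1" "deg p + deg q = K" for a b c d p q
  proof -
    obtain s t where st: "p = s + t" "deg s = 1" "deg t \<ge> 1"
      using \<open>deg p \<ge> 2\<close> by (rule deg_split)
    have deg: "deg s \<ge> 1" "deg t \<ge> 1" "deg q \<ge> 1" "deg s + deg t + deg q = K"
      using \<open>deg p + deg q = K\<close> \<open>deg q \<ge> 1\<close> st by (auto simp: deg_add)
    have eq: "Y a b (s + t) \<approx> br (Y a e s) (Y e b t)"
      if "e \<in> I" "e \<noteq> a" "e \<noteq> b" for e
      by (rule lie_eq_sym[OF lower_product];
          use \<open>{a, b, c, d} \<subseteq> I\<close> \<open>a \<noteq> b\<close> that deg in auto)
    show ?thesis
      unfolding st(1) by (rule split_commute[OF _ _ _ _ _ _ _ eq]; use that deg in auto)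
  qed
  consider "deg p \<le> 1" "deg q \<le> 1" | "deg p \<ge> 2" | "deg q \<ge> 2" by linarith
  then show ?thesis
  proof cases
    case 1
    then show ?thesis using assms by (intro gens_commute)
  next
    case 2
    then show ?thesis using assms by (intro *)
  next
    case 3
    show ?thesis
      by (rule br_zero_commute[OF Y_part Y_part *]) (use assms 3 in auto)
  qed
qed

lemma product_indep:
  assumes "{a, b, c, d} \<subseteq> I" "a \<noteq> b" "b \<noteq> c" "a \<noteq> c" "c \<noteq> d" "a \<noteq> d"
    and "deg p \<ge> 1" "deg q \<ge> 1" "deg p + deg q = K"
  shows "br (Y a b p) (Y b c q) \<approx> br (Y a d p) (Y d c q)"
proof (cases "b = d")
  case True
  show ?thesis unfolding True
    by (intro lie_eq_br Y_refl; use assms in blast)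
next
  case False
  have "br (Y a b p) (Y b c q) \<approx> br (Y a b p) (br (Y b d 0) (Y d c q))"
    by (intro lie_eq_br Y_refl lie_eq_sym[OF lower_product[of b d c 0 q, simplified]];
        use assms False in auto)
  also have "\<dots> \<approx> br (br (Y a b p) (Y b d 0)) (Y d c q)"
    by (intro br_assoc[OF Y_part Y_part Y_part inner_commute]; use assms False in auto)
  also have "\<dots> \<approx> br (Y a d p) (Y d c q)"
    by (intro lie_eq_br Y_refl lower_product[of a b d p 0, simplified];
        use assms False in auto)
  finally show ?thesis .
qed

lemma product_shift:
  assumes "{a, b, c, d} \<subseteq> I" "a \<noteq> b" "b \<noteq> c" "a \<noteq> c" "c \<noteq> d" "a \<noteq> d"
    and "deg p \<ge> 1" "deg q \<ge> 1" "deg r \<ge> 1" "deg p + deg q + deg r = K"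
  shows "br (Y a b (p + q)) (Y b c r) \<approx> br (Y a d p) (Y d c (q + r))"
proof -
  obtain e where e: "e \<in> I" "e \<notin> {a, b, c, d}" using fresh_index by blast
  have "br (Y a b (p + q)) (Y b c r) \<approx> br (br (Y a e p) (Y e b q)) (Y b c r)"
    by (intro lie_eq_br Y_refl lie_eq_sym[OF lower_product]; use assms e in auto)
  also have "\<dots> \<approx> br (Y a e p) (br (Y e b q) (Y b c r))"
    by (intro lie_eq_sym[OF br_assoc[OF Y_part Y_part Y_part lower_commute]];
        use assms e in auto)
  also have "\<dots> \<approx> br (Y a e p) (Y e c (q + r))"
    by (intro lie_eq_br Y_refl lower_product; use assms e in auto)
  also have "\<dots> \<approx> br (Y a d p) (Y d c (q + r))"
    by (intro product_indep; use assms e in auto)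
  finally show ?thesis .
qed

lemma product_factor_free:
  assumes "{a, b, c, d} \<subseteq> I" "a \<noteq> b" "b \<noteq> c" "a \<noteq> c" "c \<noteq> d" "a \<noteq> d"
    and "deg p \<ge> 1" "deg q \<ge> 1" "deg s = 1" "deg t \<ge> 1" "p + q = s + t" "deg p + deg q = K"
  shows "br (Y a b p) (Y b c q) \<approx> br (Y a d s) (Y d c t)"
proof (cases "K = 2")
  case True
  have "deg p + deg q = deg s + deg t" using assms(11) by (metis deg_add)
  then have t: "deg t = 1" using assms(9,12) True by simp
  then have "deg p = 1" "deg q = 1" using assms(7-9,12) True by simp_all
  then show ?thesis by (intro gens_product_indep assms t)
next
  case False
  have in_right: "br (Y a b p) (Y b c q) \<approx> br (Y a d s) (Y d c t)"
    if "q = s + r" "deg r \<ge> 1" "deg p \<ge> 1" "p + r = t" "deg p + deg q = K" for p q r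
  proof -
    have "br (Y a b p) (Y b c (s + r)) \<approx> br (Y a b (p + s)) (Y b c r)"
      by (intro lie_eq_sym[OF product_shift]; use assms that in auto)
    moreover have "br (Y a b (s + p)) (Y b c r) \<approx> br (Y a d s) (Y d c (p + r))"
      by (intro product_shift; use assms that in auto)
    ultimately show ?thesis using that lie_eq_trans by (metis add.commute)
  qed
  have "fst s \<le> fst p \<and> snd s \<le> snd p \<or> fst s \<le> fst q \<and> snd s \<le> snd q"
    using assms(9,11) by (cases p; cases q; cases s; cases t) auto
  then consider r where "p = s + r" | r where "q = s + r"
    by (metis (no_types) le_add_diff_inverse prod.collapse add_Pair)
  then show ?thesis
  proof cases
    case (1 r)
    then have t: "t = r + q" using assms(11) by (simp add: add.assoc)
    show ?thesis
    proof (cases "r = 0")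
      case True
      then have "p = s" "q = t" using 1 t by simp_all
      then show ?thesis using product_indep assms by blast
    next
      case False
      then have "deg r \<ge> 1" by (simp only: deg_ge_1_iff not_False_eq_True)
      then have "deg s \<ge> 1" "deg q \<ge> 1" "deg r \<ge> 1" "deg s + deg r + deg q = K"
        using assms(8,9,12) by (simp_all add: 1)
      then show ?thesis unfolding 1 t by (intro product_shift assms(1-6))
    qed
  next
    case (2 r)
    then have t: "t = p + r" using assms(11) by (metis add.left_commute add_left_imp_eq)
    show ?thesis
    proof (cases "r = 0")
      case True
      then have q: "q = s" and "t = p" using 2 t by auto
      then have "deg p \<ge> 2" using assms False K by simp
      then obtain p1 p2 where p: "p = p1 + p2" "deg p1 = 1" "deg p2 \<ge> 1" by (rule deg_split)
      have "br (Y a b (p1 + p2)) (Y b c q) \<approx> br (Y a b p1) (Y b c (p2 + q))"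
        by (intro product_shift; use assms p in auto)
      also have "\<dots> \<approx> br (Y a d s) (Y d c t)"
        by (rule in_right[of _ p2]) (use assms p q \<open>t = p\<close> in \<open>auto simp: add.commute\<close>)
      finally show ?thesis using p by simp
    next
      case False
      then have "deg r \<ge> 1" by (simp only: deg_ge_1_iff not_False_eq_True)
      from in_right[OF 2 this assms(7) t[symmetric] assms(12)] show ?thesis .
    qed
  qed
qed

lemma inner_product:
  assumes "{a, b, c} \<subseteq> I" "a \<noteq> b" "b \<noteq> c" "a \<noteq> c"
    and "deg p \<ge> 1" "deg q \<ge> 1" "deg p + deg q = K"
  shows "br (Y a b p) (Y b c q) \<approx> Y a c (p + q)"
proof -
  have "deg (p + q) \<ge> 2" using assms K by simp
  then obtain e s t where e: "e \<in> I" "e \<noteq> a" "e \<noteq> c"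
    and st: "p + q = s + t" "deg s = 1" "deg t \<ge> 1"
    and eq: "Y a c (p + q) = br (Y a e s) (Y e c t)"
    using Y_split[OF _ _ \<open>a \<noteq> c\<close> \<open>deg (p + q) \<ge> 2\<close>] assms(1) by blast
  show ?thesis
    unfolding eq
    by (rule product_factor_free[OF _ assms(2-4) _ _ assms(5,6) st(2,3,1) assms(7)])
      (use assms(1) e in blast)+
qed

lemma product_step:
  assumes "{a, b, c} \<subseteq> I" "a \<noteq> b" "b \<noteq> c" "a \<noteq> c" "deg p + deg q = K"
  shows "br (Y a b p) (Y b c q) \<approx> Y a c (p + q)"
proof -
  obtain d where d: "d \<in> I" "d \<notin> {a, b, c, c}" using fresh_index by blast
  from assms(5) show ?thesis
  proof (cases rule: deg_sum_cases)
    case 1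
    then show ?thesis using assms by (intro inner_product)
  next
    case 2
    then have "deg q \<ge> 2" using K by simp
    then obtain s t where st: "q = s + t" "deg s = 1" "deg t \<ge> 1" by (rule deg_split)
    have "br (Y a b 0) (Y b c (s + t))
        \<approx> br (Y a b 0) (br (Y b d s) (Y d c t))"
      by (intro lie_eq_br Y_refl lie_eq_sym[OF inner_product]; use assms st d 2 in auto)
    also have "\<dots> \<approx> br (br (Y a b 0) (Y b d s)) (Y d c t)"
      by (intro br_assoc[OF Y_part Y_part Y_part lower_commute]; use assms st d 2 in auto)
    also have "\<dots> \<approx> br (Y a d s) (Y d c t)"
      by (intro lie_eq_br Y_refl lower_product[of a b d 0 s, simplified];
          use assms st d 2 in auto)
    also have "\<dots> \<approx> Y a c (s + t)"
      by (intro inner_product; use assms st d 2 in auto)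
    finally show ?thesis using 2 st by simp
  next
    case 3
    then have "deg p \<ge> 2" using K by simp
    then obtain s t where st: "p = s + t" "deg s = 1" "deg t \<ge> 1" by (rule deg_split)
    have "br (Y a b (s + t)) (Y b c 0)
        \<approx> br (br (Y a d s) (Y d b t)) (Y b c 0)"
      by (intro lie_eq_br Y_refl lie_eq_sym[OF inner_product]; use assms st d 3 in auto)
    also have "\<dots> \<approx> br (Y a d s) (br (Y d b t) (Y b c 0))"
      by (intro lie_eq_sym[OF br_assoc[OF Y_part Y_part Y_part lower_commute]];
          use assms st d 3 in auto)
    also have "\<dots> \<approx> br (Y a d s) (Y d c t)"
      by (intro lie_eq_br Y_refl lower_product[of d b c t 0, simplified];
          use assms st d 3 in auto)
    also have "\<dots> \<approx> Y a c (s + t)"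
      by (intro inner_product; use assms st d 3 in auto)
    finally show ?thesis using 3 st by simp
  qed
qed

lemma commute_step:
  assumes "{a, b, c, d} \<subseteq> I" "a \<noteq> b" "b \<noteq> c" "c \<noteq> d" "d \<noteq> a" "deg p + deg q = K"
  shows "br (Y a b p) (Y c d q) \<approx> 0"
proof -
  have *: "br (Y a b p) (Y c d 0) \<approx> 0"
    if "{a, b, c, d} \<subseteq> I" "a \<noteq> b" "b \<noteq> c" "c \<noteq> d" "d \<noteq> a" "deg p = K" for a b c d p
  proof -
    have "deg p \<ge> 2" using K that by simp
    then obtain s t where st: "p = s + t" "deg s = 1" "deg t \<ge> 1" by (rule deg_split)
    have deg: "deg s \<ge> 1" "deg t \<ge> 1" "deg s + deg t = K" "deg (0 :: nat \<times> nat) = 0"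
      using \<open>deg p = K\<close> st by (auto simp: deg_add)
    have eq: "Y a b (s + t) \<approx> br (Y a e s) (Y e b t)"
      if "e \<in> I" "e \<noteq> a" "e \<noteq> b" for e
      by (rule lie_eq_sym[OF inner_product];
          use \<open>{a, b, c, d} \<subseteq> I\<close> \<open>a \<noteq> b\<close> that deg in auto)
    show ?thesis
      unfolding st(1) by (rule split_commute[OF _ _ _ _ _ _ _ eq]; use that deg in auto)
  qed
  from assms(6) show ?thesis
  proof (cases rule: deg_sum_cases)
    case 1
    then show ?thesis using assms by (intro inner_commute)
  next
    case 2
    show ?thesis
      by (rule br_zero_commute[OF Y_part Y_part]) (use * assms 2 in auto)
  next
    case 3
    then show ?thesis using * assms by metis
  qed
qed

end

lemma Y_product_commute:
  "(\<forall>a b c. {a, b, c} \<subseteq> I \<and> a \<noteq> b \<and> b \<noteq> c \<and> a \<noteq> c \<longrightarrow>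
      br (Y a b p) (Y b c q) \<approx> Y a c (p + q)) \<and>
   (\<forall>a b c d. {a, b, c, d} \<subseteq> I \<and> a \<noteq> b \<and> b \<noteq> c \<and> c \<noteq> d \<and> d \<noteq> a \<longrightarrow>
      br (Y a b p) (Y c d q) \<approx> 0)"
proof (induction "deg p + deg q" arbitrary: p q rule: less_induct)
  case less
  show ?case
  proof (cases "deg p + deg q \<ge> 2")
    case True
    have "br (Y a b p') (Y b c q') \<approx> Y a c (p' + q')"
      if "{a, b, c} \<subseteq> I" "a \<noteq> b" "b \<noteq> c" "a \<noteq> c" "deg p' + deg q' < deg p + deg q" for a b c p' q'
      using less[OF that(5)] that(1-4) by blast
    moreover have "br (Y a b p') (Y c d q') \<approx> 0"
      if "{a, b, c, d} \<subseteq> I" "a \<noteq> b" "b \<noteq> c" "c \<noteq> d" "d \<noteq> a" "deg p' + deg q' < deg p + deg q"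
      for a b c d p' q'
      using less[OF that(6)] that(1-5) by blast
    ultimately show ?thesis
      by (intro conjI allI impI; elim conjE)
        (rule product_step[OF True] commute_step[OF True]; (assumption | rule refl))+
  next
    case False
    then show ?thesis by (auto intro!: gens_product gens_commute)
  qed
qed

lemma Y_product:
  "\<lbrakk>{a, b, c} \<subseteq> I; a \<noteq> b; b \<noteq> c; a \<noteq> c\<rbrakk> \<Longrightarrow>
    br (Y a b p) (Y b c q) \<approx> Y a c (p + q)"
  by (rule Y_product_commute[THEN conjunct1, rule_format]) simp

lemma Y_commute:
  "\<lbrakk>{a, b, c, d} \<subseteq> I; a \<noteq> b; b \<noteq> c; c \<noteq> d; d \<noteq> a\<rbrakk> \<Longrightarrow> br (Y a b p) (Y c d q) \<approx> 0"
  by (rule Y_product_commute[THEN conjunct2, rule_format]) simp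

end

section \<open>Linear extension from monomials\<close>

text \<open>The pair \<open>(i, j)\<close> stands for \<open>u\<^sup>i v\<^sup>j\<close>, which is \<open>monom (monom 1 i) j\<close>.\<close>

definition lin_ext :: "(nat \<times> nat \<Rightarrow> 'g free_alg) \<Rightarrow> poly_uv \<Rightarrow> 'g free_alg" where
  "lin_ext f P = (\<Sum>j\<le>degree P. \<Sum>i\<le>degree (coeff P j). scale (coeff (coeff P j) i) (f (i, j)))"

lemma sum_coeffs_mono:
  assumes "\<And>i. g i 0 = 0" "degree P \<le> N"
  shows "(\<Sum>i\<le>degree P. g i (coeff P i)) = (\<Sum>i\<le>N. g i (coeff P i))"
  using assms by (intro sum.mono_neutral_left) (auto simp: coeff_eq_0)

lemma sum_coeffs_add:
  fixes g :: "nat \<Rightarrow> 'a::comm_monoid_add \<Rightarrow> 'b::ab_group_add"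
  assumes "\<And>i x y. g i (x + y) = g i x + g i y"
  shows "(\<Sum>i\<le>degree (P + Q). g i (coeff (P + Q) i)) =
    (\<Sum>i\<le>degree P. g i (coeff P i)) + (\<Sum>i\<le>degree Q. g i (coeff Q i))"
proof -
  have "g i 0 = 0" for i using assms[of i 0 0] by simp
  note mono = sum_coeffs_mono[of g, OF this, where N = "max (degree P) (degree Q)"]
  show ?thesis
    unfolding mono[OF degree_add_le_max] mono[OF max.cobounded1] mono[OF max.cobounded2]
    by (simp add: assms sum.distrib)
qed

lemma lin_ext_add: "lin_ext f (P + Q) = lin_ext f P + lin_ext f Q"
proof -
  let ?g = "\<lambda>j p. \<Sum>i\<le>degree p. scale (coeff p i) (f (i, j))"
  have "?g j (p + q) = ?g j p + ?g j q" for j p q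
    using sum_coeffs_add[of "\<lambda>i c. scale c (f (i, j))"] by (simp only: scale_simps)
  from sum_coeffs_add[of ?g, OF this] show ?thesis unfolding lin_ext_def .
qed

lemma lin_ext_zero [simp]: "lin_ext f 0 = 0"
  using lin_ext_add[of f 0 0] by simp

lemma lin_ext_scale: "lin_ext f (scale_uv c P) = scale c (lin_ext f P)"
  by (cases "c = 0") (simp_all add: lin_ext_def scale_uv_def scale_sum scale_simps)

lemma lin_ext_monom: "lin_ext f (monom (monom c i) j) = scale c (f (i, j))"
proof (cases "c = 0")
  case False
  have "lin_ext f (monom (monom c i) j) = (\<Sum>l\<le>j. if j = l then scale c (f (i, l)) else 0)"
    using False unfolding lin_ext_def
    by (intro sum.cong) (auto simp: degree_monom_eq scale_simps
      if_distrib[of "\<lambda>c. scale c _"] cong: if_cong)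
  then show ?thesis by simp
qed (simp add: scale_simps)

lemma var_eq_monom:
  "var_u = monom (monom 1 1) 0" "var_v = monom (monom 1 0) 1"
  by (simp_all add: var_u_def var_v_def monom_0 monom_Suc one_pCons)

lemma lin_ext_label:
  "lin_ext f 1 = f (0, 0)" "lin_ext f var_u = f (1, 0)" "lin_ext f var_v = f (0, 1)"
  using lin_ext_monom[of f 1 0 0] lin_ext_monom[of f 1 1 0] lin_ext_monom[of f 1 0 1]
  by (simp_all add: var_eq_monom scale_simps)

lemma poly_uv_induct [case_names zero monom add]:
  fixes P :: poly_uv
  assumes "Q 0" and monom: "\<And>c i j. Q (monom (monom c i) j)"
    and add: "\<And>P P'. Q P \<Longrightarrow> Q P' \<Longrightarrow> Q (P + P')"
  shows "Q P"
proof -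
  have sum: "Q (sum f A)" if "\<And>i. Q (f i)" for f :: "nat \<Rightarrow> poly_uv" and A
    using that by (induction A rule: infinite_finite_induct) (simp_all add: assms)
  have "P = (\<Sum>j\<le>degree P. \<Sum>i\<le>degree (coeff P j). monom (monom (coeff (coeff P j) i) i) j)"
    by (subst (1) poly_as_sum_of_monoms[of P, symmetric],
        simp add: poly_as_sum_of_monoms flip: monom_sum)
  also have "Q \<dots>" by (intro sum monom)
  finally show ?thesis .
qed

lemma (in presentation) lin_ext_br:
  assumes "\<And>q r. br (f q) (g r) \<approx> h (q + r)"
  shows "br (lin_ext f P) (lin_ext g Q) \<approx> lin_ext h (P * Q)"
proof -
  have zero: "br 0 x = 0" "br x 0 = 0" for x :: "'g free_alg"
    using br_diff_left[of 0 0 x] br_diff_right[of x 0 0] by simp_all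
  have refl: "0 \<approx> 0" by (simp add: lie_eq_refl free_carrier_closed)
  have monom: "br (lin_ext f (monom (monom c i) j)) (lin_ext g Q) \<approx> lin_ext h (monom (monom c i) j * Q)"
    for c i j
  proof (induction Q rule: poly_uv_induct)
    case (monom d k l)
    show ?case
      using lie_eq_scale[OF assms[of "(i, j)" "(k, l)"], of "c * d"]
      by (simp add: lin_ext_monom mult_monom br_scale_left br_scale_right scale_simps
          mult.commute[of d c])
  qed (simp_all add: zero refl lin_ext_add br_add_right lie_eq_add distrib_left)
  show ?thesis
    by (induction P rule: poly_uv_induct)
      (simp_all add: zero refl monom lin_ext_add br_add_left lie_eq_add distrib_right)
qed

lemma lin_ext_const_zero [simp]: "lin_ext (\<lambda>_. 0) P = 0"
  by (simp add: lin_ext_def scale_simps)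

lemma lin_ext_part: "(\<And>q. f q \<in> free_part G p d) \<Longrightarrow> lin_ext f P \<in> free_part G p d"
  unfolding lin_ext_def by (intro free_part_sum free_part_closed(4))

section \<open>The two Steinberg presentations\<close>

definition mid :: "nat \<Rightarrow> nat \<Rightarrow> nat" where
  "mid a b = (if 1 \<notin> {a, b} then 1 else if 2 \<notin> {a, b} then 2 else 3)"

fun mon_F :: "nat \<Rightarrow> nat \<Rightarrow> nat \<times> nat \<Rightarrow> poly_uv st_gen free_alg" where
  "mon_F a b (0, 0) = F a b 1"
| "mon_F a b (0, Suc 0) = F a b var_v"
| "mon_F a b (0, Suc (Suc j)) = br (F a (mid a b) var_v) (mon_F (mid a b) b (0, Suc j))"
| "mon_F a b (Suc 0, 0) = F a b var_u"
| "mon_F a b (Suc (Suc i), 0) = br (F a (mid a b) var_u) (mon_F (mid a b) b (Suc i, 0))"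
| "mon_F a b (Suc i, Suc j) = br (F a (mid a b) var_u) (mon_F (mid a b) b (i, Suc j))"

lemma mon_F_step:
  assumes "s = (1, 0) \<or> s = (0, 1) \<and> fst r = 0" "r \<noteq> 0"
  shows "mon_F a b (s + r) = br (mon_F a (mid a b) s) (mon_F (mid a b) b r)"
proof (cases r)
  case (Pair i j)
  with assms show ?thesis
    by (cases i; cases j) (auto simp: zero_prod_def)
qed

lemma steinberg_rels_homogeneous:
  "steinberg_rels sc m n \<subseteq> (\<Union>d. free_part (st_gens m n UNIV) (st_parity m) d)"
proof -
  note mem = F_in_part[of _ m n _ _ UNIV] br_F_in_part[of _ m n _ _ UNIV]
  show ?thesis
    unfolding steinberg_rels_def Let_def
    by (intro Un_least; clarify; rule UN_I[OF UNIV_I];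
        (rule free_part_closed(2-4) mem free_part_closed(5)[OF mem(1) mem(1)] | simp)+)
qed

lemma label_power: "w \<in> {var_u, var_v} \<Longrightarrow> k \<le> 1 \<Longrightarrow> w ^ k \<in> {1, var_u, var_v}" for k :: nat
  by (cases k) auto

lemma steinberg_tilde_rels_homogeneous:
  "steinberg_tilde_rels m n \<subseteq>
    (\<Union>d. free_part (st_gens m n {1, var_u, var_v}) (st_parity m) d)"
proof -
  note mem = F_in_part[of _ m n _ _ "{1, var_u, var_v}"]
    br_F_in_part[of _ m n _ _ "{1, var_u, var_v}"]
  show ?thesis
    unfolding steinberg_tilde_rels_def Let_def
    by (intro Un_least; clarify; rule UN_I[OF UNIV_I];
        (rule free_part_closed(2-4) mem free_part_closed(5)[OF mem(1) mem(1)]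
          label_power | (auto; fail))+)
qed

locale steinberg_tilde_pres =
  fixes m n :: nat
  assumes size: "m + n \<ge> 5"
begin

abbreviation "I \<equiv> {1..m+n}"
abbreviation "G \<equiv> st_gens m n {1, var_u, var_v}"
abbreviation "P \<equiv> free_part G (st_parity m)"

sublocale presentation G "st_parity m" "steinberg_tilde_rels m n"
  by unfold_locales (rule steinberg_tilde_rels_homogeneous)

notation lie_eq (infix "\<approx>" 50)

lemma mid: "mid a b \<in> I" "mid a b \<noteq> a" "mid a b \<noteq> b" "a \<noteq> mid a b" "b \<noteq> mid a b"
  using size by (auto simp: mid_def)

lemma fresh_index:
  obtains e where "e \<in> I" "e \<notin> {a, b, c, d}"
proof -
  have "card {a, b, c, d} < card I"
    using size by (simp add: card_insert_if)
  then have "\<not> I \<subseteq> {a, b, c, d}"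
    by (metis card_mono finite.emptyI finite.insertI linorder_not_less)
  then show ?thesis using that by blast
qed

lemma mon_F_part:
  assumes "a \<in> I" "b \<in> I" "a \<noteq> b"
  shows "mon_F a b p \<in> P (index_parity m a + index_parity m b)"
  using assms
proof (induction "deg p" arbitrary: a b p rule: less_induct)
  case less
  note gen = F_in_part[of _ m n _ _ "{1, var_u, var_v}"]
  consider "p = 0" | "p = (1, 0)" | "p = (0, 1)" | "deg p \<ge> 2"
  proof -
    have "p = 0 \<or> deg p = 1 \<or> deg p \<ge> 2" by (cases p) (auto simp: zero_prod_def)
    then show thesis using that deg_eq_1_iff by blast
  qed
  then show ?case
  proof cases
    case 4
    then obtain s t where st: "p = s + t" "deg s = 1" "deg t \<ge> 1"
      "s = (1, 0) \<or> s = (0, 1) \<and> fst t = 0" by (rule deg_split)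
    let ?e = "mid a b"
    have "t \<noteq> 0" using st by auto
    then have "mon_F a b p = br (mon_F a ?e s) (mon_F ?e b t)"
      using mon_F_step st by blast
    moreover have "mon_F a ?e s \<in> P (index_parity m a + index_parity m ?e)"
      using less st mid by (intro less(1)) auto
    moreover have "mon_F ?e b t \<in> P (index_parity m ?e + index_parity m b)"
      using less st mid by (intro less(1)) auto
    moreover have "index_parity m a + index_parity m ?e + (index_parity m ?e + index_parity m b)
        = index_parity m a + index_parity m b"
      by (simp add: index_parity_def)
    ultimately show ?thesis using free_part_closed(5) by metis
  qed (use less gen in \<open>simp_all add: zero_prod_def\<close>)
qed

lemma relator_eq_zero: "r \<in> steinberg_tilde_rels m n \<Longrightarrow> r \<approx> 0"
  by (simp add: lie_eq_zero_iff lie_ideal.relator)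

lemma mon_F_zero: "mon_F a b 0 = F a b 1"
  by (simp add: zero_prod_def)

lemma gens_commute:
  assumes "{a, b, c, d} \<subseteq> I" "a \<noteq> b" "b \<noteq> c" "c \<noteq> d" "d \<noteq> a" "deg p \<le> 1" "deg q \<le> 1"
  shows "br (mon_F a b p) (mon_F c d q) \<approx> 0"
proof -
  have rel: "br (F a b x) (F c d y) \<approx> 0"
    if "(x, y) \<in> {(var_u, var_u), (var_u, var_v), (var_v, var_v), (var_u, 1), (var_v, 1), (1, 1)}"
      "{a, b, c, d} \<subseteq> I" "a \<noteq> b" "b \<noteq> c" "c \<noteq> d" "d \<noteq> a" for a b c d x y
    by (rule relator_eq_zero, unfold steinberg_tilde_rels_def Let_def) (use that in blast)
  have sw: "br (F a b x) (F c d y) \<approx> 0"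
    if "(x, y) \<in> {(var_v, var_u), (1, var_u), (1, var_v)}" for x y
    by (rule br_zero_commute[OF F_in_part F_in_part rel]) (use assms that in auto)
  show ?thesis
    using deg_le_1[OF assms(6)] deg_le_1[OF assms(7)] 
    by (elim disjE; simp add: mon_F_zero rel[OF _ assms(1-5)] sw)
qed

lemma gens_product:
  assumes "{a, b, c} \<subseteq> I" "a \<noteq> b" "b \<noteq> c" "a \<noteq> c" "deg p + deg q \<le> 1"
  shows "br (mon_F a b p) (mon_F b c q) \<approx> mon_F a c (p + q)"
proof -
  have "br (F a b (w ^ i)) (F b c (w ^ j)) \<approx> F a c (w ^ (i + j))"
    if "w \<in> {var_u, var_v}" "i + j \<in> {0, 1}" for w i j
  proof (rule iffD2[OF lie_eq_iff_diff])
    have "i \<le> 1" "j \<le> 1" "i + j \<le> 1" using that(2) by auto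
    note pow = this[THEN label_power[OF that(1)]]
    show "br (F a b (w ^ i)) (F b c (w ^ j)) \<in> free_carrier G" "F a c (w ^ (i + j)) \<in> free_carrier G"
      by (rule free_part_subset[OF br_F_in_part] free_part_subset[OF F_in_part];
          use assms pow that in \<open>blast | simp\<close>)+
    show "br (F a b (w ^ i)) (F b c (w ^ j)) - F a c (w ^ (i + j)) \<approx> 0"
      by (rule relator_eq_zero, unfold steinberg_tilde_rels_def Let_def) (use assms that in blast)
  qed
  note * = this
  have "br (F a b 1) (F b c 1) \<approx> F a c 1"
    using *[of var_u 0 0] by simp
  moreover have "br (F a b w) (F b c 1) \<approx> F a c w" "br (F a b 1) (F b c w) \<approx> F a c w"
    if "w \<in> {var_u, var_v}" for w
    using *[OF that, of 1 0] *[OF that, of 0 1] by simp_all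
  moreover have "p = 0 \<and> q = 0 \<or> p = (1, 0) \<and> q = 0 \<or> p = 0 \<and> q = (1, 0)
      \<or> p = (0, 1) \<and> q = 0 \<or> p = 0 \<and> q = (0, 1)"
  proof -
    have "p = 0 \<or> p = (1, 0) \<or> p = (0, 1)" "q = 0 \<or> q = (1, 0) \<or> q = (0, 1)"
      using assms(5) by (intro deg_le_1; simp)+
    then show ?thesis using assms(5) by (elim disjE) simp_all
  qed
  ultimately show ?thesis by (auto simp: mon_F_zero)
qed

lemma gens_product_indep:
  assumes "{a, b, c, d} \<subseteq> I" "a \<noteq> b" "b \<noteq> c" "a \<noteq> c" "c \<noteq> d" "a \<noteq> d"
    and "deg p = 1" "deg q = 1" "deg s = 1" "deg t = 1" "p + q = s + t"
  shows "br (mon_F a b p) (mon_F b c q) \<approx> br (mon_F a d s) (mon_F d c t)"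
proof -
  have rel: "br (F a b x) (F b c y) \<approx> br (F a d x') (F d c y')"
    if "(x, y, x', y') \<in> {(var_u, var_u, var_u, var_u), (var_u, var_v, var_v, var_u),
        (var_v, var_v, var_v, var_v)}" "{a, b, c, d} \<subseteq> I" "a \<noteq> b" "b \<noteq> c" "a \<noteq> c" "c \<noteq> d" "a \<noteq> d"
    for x y x' y' a b c d
  proof (rule iffD2[OF lie_eq_iff_diff])
    show "br (F a b x) (F b c y) \<in> free_carrier G" "br (F a d x') (F d c y') \<in> free_carrier G"
      using that by (auto intro!: free_part_subset[OF br_F_in_part])
    show "br (F a b x) (F b c y) - br (F a d x') (F d c y') \<approx> 0"
      by (rule relator_eq_zero, unfold steinberg_tilde_rels_def Let_def) (use that in blast)
  qed
  note uv_vu = rel[of var_u var_v var_v var_u a _ c _, simplified]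
  have bd: "br (F a b var_u) (F b c var_v) \<approx> br (F a d var_v) (F d c var_u)"
    and dd: "br (F a d var_u) (F d c var_v) \<approx> br (F a d var_v) (F d c var_u)"
    and db: "br (F a b var_v) (F b c var_u) \<approx> br (F a d var_u) (F d c var_v)"
    using assms(1-6) by (auto intro: uv_vu lie_eq_sym[OF uv_vu])
  note * = bd db lie_eq_trans[OF bd lie_eq_sym[OF dd]] lie_eq_trans[OF db dd]
  show ?thesis
    using assms(7-11) * rel[OF _ assms(1-6)] unfolding deg_eq_1_iff by auto
qed

sublocale mon: monomial_family G "st_parity m" "steinberg_tilde_rels m n" I
  "\<lambda>a b. index_parity m a + index_parity m b" mon_F
proof
  show "\<exists>e\<in>I. e \<notin> {a, b, c, d}" for a b c d
    using fresh_index by metis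
  show "\<exists>e\<in>I - {a, b}. \<exists>s t. r = s + t \<and> deg s = 1 \<and> deg t \<ge> 1 \<and>
      mon_F a b r = br (mon_F a e s) (mon_F e b t)"
    if r: "deg r \<ge> 2" for a b r
  proof -
    obtain s t where st: "r = s + t" "deg s = 1" "deg t \<ge> 1"
      "s = (1, 0) \<or> s = (0, 1) \<and> fst t = 0" using r by (rule deg_split)
    then have "mon_F a b r = br (mon_F a (mid a b) s) (mon_F (mid a b) b t)"
      using mon_F_step deg_ge_1_iff by blast
    then show ?thesis using st mid by blast
  qed
qed (fact mon_F_part gens_commute gens_product gens_product_indep)+

end

lemma scale_uv_monom: "scale_uv c (monom (monom 1 i) j) = monom (monom c i) j"
  by (simp add: scale_uv_def smult_monom)

lemma steinberg_relsI:
  "\<lbrakk>{i, j} \<subseteq> {1..m+n}; i \<noteq> j\<rbrakk> \<Longrightarrow>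
    F i j (a + b) - (F i j a + F i j b) \<in> steinberg_rels sc m n"
  "\<lbrakk>{i, j} \<subseteq> {1..m+n}; i \<noteq> j\<rbrakk> \<Longrightarrow>
    F i j (sc c a) - scale c (F i j a) \<in> steinberg_rels sc m n"
  "\<lbrakk>{i, j, k} \<subseteq> {1..m+n}; i \<noteq> j; j \<noteq> k; i \<noteq> k\<rbrakk> \<Longrightarrow>
    br (F i j a) (F j k b) - F i k (a * b) \<in> steinberg_rels sc m n"
  "\<lbrakk>{i, j, k, q} \<subseteq> {1..m+n}; i \<noteq> j; j \<noteq> k; k \<noteq> q; q \<noteq> i\<rbrakk> \<Longrightarrow>
    br (F i j a) (F k q b) \<in> steinberg_rels sc m n"
  unfolding steinberg_rels_def Let_def by blast+

definition poly_F :: "poly_uv st_gen \<Rightarrow> poly_uv st_gen free_alg" where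
  "poly_F = (\<lambda>(a, b, P). lin_ext (mon_F a b) P)"

context steinberg_tilde_pres
begin

abbreviation "G' \<equiv> st_gens m n (UNIV :: poly_uv set)"
abbreviation "R' \<equiv> steinberg_rels scale_uv m n"

interpretation st: presentation G' "st_parity m" R'
  by unfold_locales (rule steinberg_rels_homogeneous)

lemma poly_F_part:
  assumes "g \<in> G'"
  shows "poly_F g \<in> P (st_parity m g)"
proof -
  obtain a b x where g: "g = (a, b, x)" "a \<in> I" "b \<in> I" "a \<noteq> b"
    using assms by (auto simp: st_gens_def)
  have "st_parity m g = index_parity m a + index_parity m b"
    by (simp add: g st_parity_def del: add_bit_eq_xor)
  moreover have "poly_F g = lin_ext (mon_F a b) x" by (simp add: g poly_F_def)
  ultimately show ?thesis by (simp only: lin_ext_part[OF mon_F_part[OF g(2-4)]])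
qed

lemma poly_F_gen: "g \<in> G \<Longrightarrow> poly_F g = gen g"
  by (auto simp: poly_F_def st_gens_def lin_ext_label)

lemma steinberg_rels_lift:
  assumes "r \<in> R'"
  shows "lift poly_F r \<in> lie_ideal G (st_parity m) (steinberg_tilde_rels m n)"
proof -
  have "lift poly_F r \<approx> 0"
    using assms unfolding steinberg_rels_def Let_def
  proof (elim UnE CollectE exE conjE, goal_cases)
    case (1 i j a b)
    then show ?case
      by (simp add: lift_simps poly_F_def lin_ext_add lie_eq_refl free_carrier_closed)
  next
    case (2 i j a c)
    then show ?case
      by (simp add: lift_simps poly_F_def lin_ext_scale lie_eq_refl free_carrier_closed)
  next
    case (3 i j k a b)
    have eq: "br (lin_ext (mon_F i j) a) (lin_ext (mon_F j k) b) \<approx> lin_ext (mon_F i k) (a * b)"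
      using 3 by (intro lin_ext_br mon.Y_product)
    from iffD1[OF lie_eq_iff_diff[OF lie_eqD(1,2)[OF eq]] eq] show ?case
      by (simp add: 3(1) lift_simps poly_F_def)
  next
    case (4 i j k q a b)
    have "br (lin_ext (mon_F i j) a) (lin_ext (mon_F k q) b) \<approx> lin_ext (\<lambda>_. 0) (a * b)"
      using 4 by (intro lin_ext_br mon.Y_commute)
    then show ?case using 4 by (simp add: lift_simps poly_F_def)
  qed
  then show ?thesis by (simp add: lie_eq_zero_iff)
qed

lemma st_relator_eq_zero: "r \<in> R' \<Longrightarrow> st.lie_eq r 0"
  by (simp add: st.lie_eq_zero_iff lie_ideal.relator)

lemma st_F_carrier: "a \<in> I \<Longrightarrow> b \<in> I \<Longrightarrow> a \<noteq> b \<Longrightarrow> F a b x \<in> free_carrier G'"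
  by (rule free_part_subset[OF F_in_part]) simp_all

lemma st_product:
  assumes "a \<in> I" "b \<in> I" "c \<in> I" "a \<noteq> b" "b \<noteq> c" "a \<noteq> c"
  shows "st.lie_eq (br (F a b x) (F b c y)) (F a c (x * y))"
  by (rule iffD2[OF st.lie_eq_iff_diff];
      (intro free_carrier_closed st_F_carrier st_relator_eq_zero steinberg_relsI)?; use assms in simp)

lemma st_add:
  assumes "a \<in> I" "b \<in> I" "a \<noteq> b"
  shows "st.lie_eq (F a b (x + y)) (F a b x + F a b y)"
  by (rule iffD2[OF st.lie_eq_iff_diff];
      (intro free_carrier_closed st_F_carrier st_relator_eq_zero steinberg_relsI)?; use assms in simp)

lemma st_scale:
  assumes "a \<in> I" "b \<in> I" "a \<noteq> b"
  shows "st.lie_eq (F a b (scale_uv c x)) (scale c (F a b x))"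
  by (rule iffD2[OF st.lie_eq_iff_diff];
      (intro free_carrier_closed st_F_carrier st_relator_eq_zero steinberg_relsI)?; use assms in simp)

lemma st_mon_F:
  assumes "a \<in> I" "b \<in> I" "a \<noteq> b"
  shows "st.lie_eq (mon_F a b (i, j)) (F a b (monom (monom 1 i) j))"
proof -
  have step: "st.lie_eq (br (F a (mid a b) w) x) (F a b (w * y))"
    if "a \<in> I" "b \<in> I" "a \<noteq> b" "st.lie_eq x (F (mid a b) b y)" for a b w x y
    using that mid
    by (intro st.lie_eq_trans[OF st.lie_eq_br[OF st.lie_eq_refl[OF st_F_carrier] that(4)] st_product])
  show ?thesis
    using assms
  proof (induction a b "(i, j)" arbitrary: i j rule: mon_F.induct)
    case (3 a b j)
    have "st.lie_eq (mon_F (mid a b) b (0, Suc j)) (F (mid a b) b (monom (monom 1 0) (Suc j)))"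
      using 3 mid by blast
    from step[OF 3(2-4) this, of var_v] show ?case by (simp add: var_eq_monom mult_monom)
  next
    case (5 a b i)
    have "st.lie_eq (mon_F (mid a b) b (Suc i, 0)) (F (mid a b) b (monom (monom 1 (Suc i)) 0))"
      using 5 mid by blast
    from step[OF 5(2-4) this, of var_u] show ?case by (simp add: var_eq_monom mult_monom)
  next
    case (6 a b i j)
    have "st.lie_eq (mon_F (mid a b) b (i, Suc j)) (F (mid a b) b (monom (monom 1 i) (Suc j)))"
      using 6 mid by blast
    from step[OF 6(2-4) this, of var_u] show ?case by (simp add: var_eq_monom mult_monom)
  qed (simp_all add: var_eq_monom st.lie_eq_refl st_F_carrier)
qed

lemma st_poly_F:
  assumes "a \<in> I" "b \<in> I" "a \<noteq> b"
  shows "st.lie_eq (lin_ext (mon_F a b) x) (F a b x)"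
proof (induction x rule: poly_uv_induct)
  case zero
  have "st.lie_eq (scale 0 (F a b 0)) (F a b (scale_uv 0 0))"
    using assms by (intro st.lie_eq_sym[OF st_scale])
  moreover have "scale_uv 0 0 = 0" by (simp add: scale_uv_def)
  ultimately show ?case by (simp add: scale_simps)
next
  case (monom c i j)
  have "st.lie_eq (scale c (mon_F a b (i, j))) (scale c (F a b (monom (monom 1 i) j)))"
    using assms by (intro st.lie_eq_scale st_mon_F)
  also have "st.lie_eq \<dots> (F a b (scale_uv c (monom (monom 1 i) j)))"
    using assms by (intro st.lie_eq_sym[OF st_scale])
  finally show ?case by (simp add: lin_ext_monom scale_uv_monom)
next
  case (add x y)
  then show ?case
    using st.lie_eq_trans[OF st.lie_eq_add st.lie_eq_sym[OF st_add[OF assms]]]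
    by (simp add: lin_ext_add)
qed

lemma steinberg_tilde_rels_in_ideal:
  assumes "r \<in> steinberg_tilde_rels m n"
  shows "r \<in> lie_ideal G' (st_parity m) R'"
proof -
  have "st.lie_eq r 0"
    using assms unfolding steinberg_tilde_rels_def Let_def
  proof (elim UnE CollectE exE conjE, goal_cases)
    case (1 a b c d x y)
    show ?case unfolding 1(1) by (intro st_relator_eq_zero steinberg_relsI 1(3-6)) (rule 1(2))
  next
    case (2 a b c d x y x' y')
    then have xy: "x * y = x' * y'" by (auto simp: mult.commute)
    have "st.lie_eq (br (F a b x) (F b c y)) (br (F a d x') (F d c y'))"
      by (rule st.lie_eq_trans[OF st_product st.lie_eq_sym[OF st_product[of a d c x' y', folded xy]]])
        (use 2 in simp_all)
    from st.lie_eq_diff[OF this st.lie_eq_refl[OF st.lie_eqD(2)[OF this]]]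
    show ?case using 2 by simp
  next
    case (3 a b c w i j)
    have "st.lie_eq (br (F a b (w ^ i)) (F b c (w ^ j))) (F a c (w ^ (i + j)))"
      using 3 by (simp add: st_product power_add)
    from st.lie_eq_diff[OF this st.lie_eq_refl[OF st.lie_eqD(2)[OF this]]]
    show ?case using 3 by simp
  qed
  then show ?thesis by (simp add: st.lie_eq_zero_iff)
qed

lemma steinberg_tilde_isomorphic:
  "lie_super_isomorphic (steinberg_tilde m n) (steinberg scale_uv m n)"
  unfolding steinberg_tilde_def steinberg_def
proof (rule lie_super_isomorphic_presented[where h = gen and h' = poly_F])
  show "presentation G (st_parity m) (steinberg_tilde_rels m n)" "presentation G' (st_parity m) R'"
    by unfold_locales
  show "gen g \<in> free_part G' (st_parity m) (st_parity m g)" if "g \<in> G" for g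
    using that by (intro gen_in_part) (auto simp: st_gens_def)
  show "lift gen r \<in> lie_ideal G' (st_parity m) R'" if "r \<in> steinberg_tilde_rels m n" for r
    using that by (simp add: steinberg_tilde_rels_in_ideal)
  show "lift poly_F (gen g) - gen g \<in> lie_ideal G (st_parity m) (steinberg_tilde_rels m n)"
    if "g \<in> G" for g
    using that by (simp add: poly_F_gen lie_ideal.zero)
  show "lift gen (poly_F g) - gen g \<in> lie_ideal G' (st_parity m) R'" if g: "g \<in> G'" for g
  proof -
    obtain a b x where "g = (a, b, x)" "a \<in> I" "b \<in> I" "a \<noteq> b"
      using g by (auto simp: st_gens_def)
    then show ?thesis using st.lie_eqD(3)[OF st_poly_F, of a b x] by (simp add: poly_F_def)
  qed
qed (fact poly_F_part steinberg_rels_lift)+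

end

theorem proposition6p4:
  fixes m n :: nat
  assumes "m + n \<ge> 5"
  shows "lie_super_isomorphic (steinberg_tilde m n) (steinberg scale_uv m n)"
  using assms by (intro steinberg_tilde_pres.steinberg_tilde_isomorphic steinberg_tilde_pres.intro)

end
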